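(* For every $\lambda\in\mathbb R$ such that $0<|\lambda|<1$, the set $$\mathcal T_\lambda:=\bigl\{g\in D(\mathbb R)\;\big|\;\mathcal O\bigl(\widetilde{\mathcal V}(\overline D(0;1),[\lambda]\circ g)\bigr)=\mathbb Z\bigr\}$$ is a $G_\delta$ subset of $D(\mathbb R)$, invariant under the right action of $D(\mathbb Z)$, dense and of full measure in $D(\mathbb R)$.
   Context: For a commutative ring $A$, $D(A):=X+X^2A[[X]]$ is a group under composition of formal series. $D(\mathbb R)$ is endowed with the topology of simple convergence of coefficients; it is a Polish group, $D(\mathbb Z)$ is a closed subgroup, and $D(\mathbb R)/D(\mathbb Z)$ (quotient by the right action of $D(\mathbb Z)$) is compact and carries a unique probability measure $\bar\mu$ invariant under the left action of $D(\mathbb R)$. Let $q:D(\mathbb R)\to D(\mathbb R)/D(\mathbb Z)$ be the quotient map. A Borel subset $B$ of $D(\mathbb R)$ invariant under the right action of $D(\mathbb Z)$ has full measure when $\bar\mu(q(B))=1$. For $\lambda\in\mathbb R^*$, $[\lambda]:=\lambda X\in\mathbb R[[X]]$. For $\psi\in\mathbb R[[X]]$ with $\psi(0)=0$, $\psi'(0)\ne0$, $\widetilde{\mathcal V}(\overline D(0;1),\psi)$ is the formal-analytic arithmetic surface obtained by gluing $\operatorname{Spf}\mathbb Z[[X]]$ and the closed unit disk along $\psi$, and its algebra of regular functions is $$\mathcal O(\widetilde{\mathcal V}(\overline D(0;1),\psi))=\{\widehat\alpha\in\mathbb Z[[X]]\mid\widehat\alpha\circ\psi^{-1}\text{ has radius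 of convergence}>1\},$$ where $\psi^{-1}$ is the compositional inverse of $\psi$. It contains the constants $\mathbb Z$. *)

theory Defs
  imports
    "HOL-Analysis.Analysis"
    "HOL-Probability.Probability_Measure"
    "HOL-Algebra.Left_Coset"
begin

definition D_group :: "'a::comm_ring_1 fps monoid" where
  "D_group = \<lparr>carrier = {f. fps_nth f 0 = 0 \<and> fps_nth f 1 = 1}, mult = (oo), one = fps_X\<rparr>"

definition fps_of_int :: "int fps \<Rightarrow> real fps" where
  "fps_of_int a = Abs_fps (\<lambda>n. of_int (fps_nth a n))"

abbreviation D_real :: "real fps monoid" where
  "D_real \<equiv> D_group"

definition D_int :: "real fps set" where
  "D_int = fps_of_int ` carrier D_group"

text \<open>
  The topology of simple convergence of coefficients. The metric topology that the library puts
  on \<^typ>\<open>real fps\<close> is the X-adic one (discrete coefficients), hence not the one needed here.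
\<close>

definition D_top :: "real fps topology" where
  "D_top = pullback_topology (carrier D_real) fps_nth (powertop_real UNIV)"

definition quotient_top :: "'a topology \<Rightarrow> ('a \<Rightarrow> 'b) \<Rightarrow> 'b topology" where
  "quotient_top X f =
     topology (\<lambda>U. U \<subseteq> f ` topspace X \<and> openin X {x \<in> topspace X. f x \<in> U})"

definition borel_sigma :: "'a topology \<Rightarrow> 'a measure" where
  "borel_sigma X = sigma (topspace X) {U. openin X U}"

definition D_proj :: "real fps \<Rightarrow> real fps set" where
  "D_proj g = g <#\<^bsub>D_real\<^esub> D_int"

definition D_quot_top :: "real fps set topology" where
  "D_quot_top = quotient_top D_top D_proj"

definition invariant_prob :: "real fps set measure \<Rightarrow> bool" where
  "invariant_prob M \<longleftrightarrow>
     prob_space M \<and> sets M = sets (borel_sigma D_quot_top) \<and>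
     (\<forall>g \<in> carrier D_real. \<forall>A \<in> sets M. emeasure M ((\<lambda>C. g <#\<^bsub>D_real\<^esub> C) ` A) = emeasure M A)"

text \<open>
  The definite description is justified by existence and uniqueness of the invariant probability
  measure, a classical fact that is not established in this theory.
\<close>

definition D_quot_measure :: "real fps set measure" where
  "D_quot_measure = (THE M. invariant_prob M)"

definition right_invariant :: "real fps set \<Rightarrow> bool" where
  "right_invariant B \<longleftrightarrow> (\<forall>g \<in> B. \<forall>h \<in> D_int. g \<otimes>\<^bsub>D_real\<^esub> h \<in> B)"

definition full_measure :: "real fps set \<Rightarrow> bool" where
  "full_measure B \<longleftrightarrow>
     B \<in> sets (borel_sigma D_top) \<and> right_invariant B \<and>
     emeasure D_quot_measure (D_proj ` B) = 1"

text \<open>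
  The algebra of regular functions of the formal-analytic arithmetic surface obtained by gluing
  the formal spectrum of the integral power series and the closed unit disk along \<open>\<psi>\<close>, for
  \<open>\<psi>\<close> with zero constant term and nonzero linear term. Here \<^const>\<open>fps_inv\<close> is the
  compositional inverse (\<^const>\<open>inverse\<close> would be the multiplicative one).
\<close>

definition regular_functions :: "real fps \<Rightarrow> int fps set" where
  "regular_functions \<psi> = {\<alpha>. fps_conv_radius (fps_of_int \<alpha> oo fps_inv \<psi>) > 1}"

definition homothety :: "real \<Rightarrow> real fps" where
  "homothety l = fps_const l * fps_X"

definition T_set :: "real \<Rightarrow> real fps set" where
  "T_set l = {g \<in> carrier D_real. regular_functions (homothety l oo g) = range fps_const}"

lemma openin_quotient_top:
  "openin (quotient_top X f) U \<longleftrightarrow>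
     U \<subseteq> f ` topspace X \<and> openin X {x \<in> topspace X. f x \<in> U}"
proof -
  have "istopology (\<lambda>U. U \<subseteq> f ` topspace X \<and> openin X {x \<in> topspace X. f x \<in> U})"
    unfolding istopology_def
  proof (intro conjI allI impI)
    fix S T assume *: "S \<subseteq> f ` topspace X \<and> openin X {x \<in> topspace X. f x \<in> S}"
      "T \<subseteq> f ` topspace X \<and> openin X {x \<in> topspace X. f x \<in> T}"
    then show "S \<inter> T \<subseteq> f ` topspace X" by auto
    have "{x \<in> topspace X. f x \<in> S \<inter> T} = {x \<in> topspace X. f x \<in> S} \<inter> {x \<in> topspace X. f x \<in> T}"
      by auto
    then show "openin X {x \<in> topspace X. f x \<in> S \<inter> T}" using * by auto
  next
    fix \<K> assume *: "\<forall>K\<in>\<K>. K \<subseteq> f ` topspace X \<and> openin X {x \<in> topspace X. f x \<in> K}"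
    then show "\<Union>\<K> \<subseteq> f ` topspace X" by blast
    have "{x \<in> topspace X. f x \<in> \<Union>\<K>} = (\<Union>K\<in>\<K>. {x \<in> topspace X. f x \<in> K})" by auto
    then show "openin X {x \<in> topspace X. f x \<in> \<Union>\<K>}" using * by auto
  qed
  then show ?thesis by (simp add: quotient_top_def)
qed

lemma topspace_quotient_top: "topspace (quotient_top X f) = f ` topspace X"
proof (rule antisym)
  show "topspace (quotient_top X f) \<subseteq> f ` topspace X"
    using openin_quotient_top openin_topspace by metis
  have "{x \<in> topspace X. f x \<in> f ` topspace X} = topspace X" by auto
  then have "openin (quotient_top X f) (f ` topspace X)" by (simp add: openin_quotient_top)
  then show "f ` topspace X \<subseteq> topspace (quotient_top X f)" by (rule openin_subset)
qed

lemma quotient_map_quotient_top: "quotient_map X (quotient_top X f) f"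
  by (auto simp: quotient_map_def topspace_quotient_top openin_quotient_top)

lemma topspace_D_top: "topspace D_top = carrier D_real"
  by (simp add: D_top_def topspace_pullback_topology)

lemma topspace_D_quot_top: "topspace D_quot_top = lcosets\<^bsub>D_real\<^esub> D_int"
  by (auto simp: D_quot_top_def topspace_quotient_top topspace_D_top LCOSETS_def D_proj_def)

lemma space_invariant_prob:
  assumes "invariant_prob M"
  shows "space M = lcosets\<^bsub>D_real\<^esub> D_int"
proof -
  have "sets M = sets (borel_sigma D_quot_top)" using assms by (simp add: invariant_prob_def)
  then have "space M = space (borel_sigma D_quot_top)" by (rule sets_eq_imp_space_eq)
  then show ?thesis by (simp add: borel_sigma_def space_measure_of_conv topspace_D_quot_top)
qed

lemma D_group_comp_nth_1:
  fixes f g :: "'a::comm_ring_1 fps"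
  assumes "fps_nth g 0 = 0"
  shows "fps_nth (f oo g) 1 = fps_nth f 1 * fps_nth g 1"
  using assms by (simp add: fps_compose_nth)

lemma group_D_real: "group D_real"
proof (rule groupI)
  fix x y z :: "real fps"
  assume "x \<in> carrier D_real" "y \<in> carrier D_real" "z \<in> carrier D_real"
  then show "x \<otimes>\<^bsub>D_real\<^esub> y \<otimes>\<^bsub>D_real\<^esub> z = x \<otimes>\<^bsub>D_real\<^esub> (y \<otimes>\<^bsub>D_real\<^esub> z)"
    by (simp add: D_group_def fps_compose_assoc)
next
  fix x y :: "real fps"
  assume "x \<in> carrier D_real" "y \<in> carrier D_real"
  then show "x \<otimes>\<^bsub>D_real\<^esub> y \<in> carrier D_real"
    using D_group_comp_nth_1[of y x] by (simp add: D_group_def)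
next
  show "\<one>\<^bsub>D_real\<^esub> \<in> carrier D_real" by (simp add: D_group_def)
next
  fix x :: "real fps"
  assume "x \<in> carrier D_real"
  then have x: "fps_nth x 0 = 0" "fps_nth x 1 = 1" by (auto simp: D_group_def)
  then show "\<one>\<^bsub>D_real\<^esub> \<otimes>\<^bsub>D_real\<^esub> x = x" by (simp add: D_group_def)
  have e: "fps_inv x oo x = fps_X" using x by (intro fps_inv) auto
  have 0: "fps_nth (fps_inv x) 0 = 0" by (simp add: fps_inv_def)
  have "fps_nth (fps_inv x) 1 = 1" using D_group_comp_nth_1[of x "fps_inv x"] e x by simp
  then show "\<exists>y\<in>carrier D_real. y \<otimes>\<^bsub>D_real\<^esub> x = \<one>\<^bsub>D_real\<^esub>"
    using e 0 by (intro bexI[of _ "fps_inv x"]) (auto simp: D_group_def)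
qed

end

theory Submission
  imports Defs "HOL-Probability.Probability"
begin

text \<open>
  Write a regular function as \<open>\<alpha> = f \<circ> [l] \<circ> g\<close>, with \<open>\<alpha>\<close> integral and \<open>f\<close> analytic on a disk of
  radius larger than \<open>1\<close>. The Taylor coefficients of \<open>f \<circ> [l] = \<alpha> \<circ> g\<^sup>-\<^sup>1\<close> are then eventually smaller
  than \<open>\<rho>\<^sup>k\<close> with \<open>\<rho> = \<bar>l\<bar> < 1\<close>. For a random \<open>g\<close> this is very unlikely unless \<open>\<alpha>\<close> is constant. Let \<open>M\<close> be
  the index of the first nonzero coefficient of \<open>\<alpha>\<close> beyond the constant one. The coefficient of
  index \<open>k\<close> of \<open>\<alpha> \<circ> g\<^sup>-\<^sup>1\<close> is \<open>\<alpha>\<^sub>k - M \<alpha>\<^sub>M g\<^sub>k\<^sub>-\<^sub>M\<^sub>+\<^sub>1\<close> plus a quantity that depends only on earlier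
  coefficients of \<open>\<alpha>\<close> and of \<open>g\<close> (\<open>agree_expansion\<close>). Since \<open>M \<alpha>\<^sub>M\<close> is a nonzero integer, if the coefficients
  of \<open>g\<close> are independent and uniform in \<open>[0, 1)\<close>, the expected number of integers \<open>\<alpha>\<^sub>k\<close> that make
  this coefficient smaller than \<open>\<rho>\<^sup>k\<close> is at most \<open>10 \<rho>\<^sup>k\<close> (\<open>sum_admissible_snoc\<close>). So the expected number of
  admissible prolongations of a given prefix of \<open>\<alpha>\<close> is at most a product of the numbers \<open>10 \<rho>\<^sup>k\<close>,
  which tends to \<open>0\<close>, and there are countably many prefixes: almost every \<open>g\<close> has the
  property (\<open>AE_prescribed_in_T_set\<close>). The argument allows finitely many coefficients of \<open>g\<close> to be
  prescribed, which gives the density.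

  The law of \<open>g\<close> has to be related to the invariant measure of the quotient. A series is reduced
  modulo the right action of the integral series one coefficient at a time, so the series with
  coefficients in \<open>[0, 1)\<close> represent the quotient, and the image of the uniform product measure is an
  invariant probability: a left translation, followed by the reduction, rotates each
  coefficient by an angle that depends only on the earlier ones (\<open>distr_skew_rotation\<close>,
  \<open>translate_law\<close>). The same fact for right translations shows, by exchanging two integrals, that every
  invariant probability equals this one (\<open>invariant_prob_unique\<close>).

  Finally, the complement of the set is a countable union of closed sets (\<open>closed_bad_series\<close>): bounding
  the coefficients of \<open>f\<close> by a fixed geometric sequence confines \<open>f\<close> to a compact set, and the
  existence of \<open>f\<close> in a compact set is a closed condition on \<open>g\<close>. The same \<open>f\<close> serves
  for \<open>g\<close> and for its right translates, so these closed sets are invariant under the right action.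
\<close>

section \<open>Formal series tangent to the identity\<close>

lemma mem_D_real: "f \<in> carrier D_real \<longleftrightarrow> fps_nth f 0 = 0 \<and> fps_nth f 1 = 1"
  by (simp add: D_group_def)

lemma D_real_mult [simp]: "f \<otimes>\<^bsub>D_real\<^esub> g = f oo g"
  by (simp add: D_group_def)

lemma D_real_comp:
  assumes "f \<in> carrier D_real" "g \<in> carrier D_real"
  shows "f oo g \<in> carrier D_real"
  using assms D_group_comp_nth_1[of g f] by (simp add: mem_D_real)

lemma fps_X_in_D_real: "fps_X \<in> carrier D_real"
  by (simp add: mem_D_real)

lemma D_real_inv:
  assumes "f \<in> carrier D_real"
  shows "fps_inv f \<in> carrier D_real" "fps_inv f oo f = fps_X" "f oo fps_inv f = fps_X"
proof -
  show 1: "fps_inv f oo f = fps_X" "f oo fps_inv f = fps_X"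
    using assms fps_inv[of f] fps_inv_right[of f] by (auto simp: mem_D_real)
  have "fps_nth (fps_inv f) 1 = 1"
    using 1(1) D_group_comp_nth_1[of f "fps_inv f"] assms by (simp add: mem_D_real)
  then show "fps_inv f \<in> carrier D_real"
    by (simp add: mem_D_real fps_inv_def)
qed

lemma D_real_comp_assoc:
  assumes "g \<in> carrier D_real" "h \<in> carrier D_real"
  shows "(f oo g) oo h = f oo (g oo h)"
  using assms by (simp add: mem_D_real fps_compose_assoc)

definition int_series :: "real fps set" where
  "int_series = {f. \<forall>n. fps_nth f n \<in> \<int>}"

lemma int_series_eq: "int_series = range fps_of_int"
proof (intro equalityI subsetI)
  fix f assume "f \<in> int_series"
  then have "f = fps_of_int (Abs_fps (\<lambda>n. \<lfloor>fps_nth f n\<rfloor>))"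
    by (intro fps_ext) (auto simp: int_series_def fps_of_int_def elim: Ints_cases)
  then show "f \<in> range fps_of_int" by blast
qed (auto simp: int_series_def fps_of_int_def)

lemma D_int_eq: "D_int = carrier D_real \<inter> int_series"
  by (auto simp: D_int_def int_series_eq mem_D_real fps_of_int_def D_group_def)

lemma int_series_power:
  assumes "f \<in> int_series"
  shows "f ^ i \<in> int_series"
proof (induction i)
  case (Suc i)
  then show ?case
    using assms by (auto simp: int_series_def fps_mult_nth intro!: Ints_sum Ints_mult)
qed (auto simp: int_series_def)

lemma int_series_compose:
  assumes "f \<in> int_series" "g \<in> int_series"
  shows "f oo g \<in> int_series"
  using assms(1) int_series_power[OF assms(2)]
  by (auto simp: int_series_def fps_compose_nth intro!: Ints_sum Ints_mult)

lemma D_int_comp: "f \<in> D_int \<Longrightarrow> g \<in> D_int \<Longrightarrow> f oo g \<in> D_int"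
  by (auto simp: D_int_eq D_real_comp int_series_compose)

lemma D_int_inv:
  assumes "f \<in> D_int"
  shows "fps_inv f \<in> D_int"
proof -
  have f: "f \<in> carrier D_real" "f \<in> int_series" using assms by (auto simp: D_int_eq)
  have "compinv f n \<in> \<int>" for n
  proof (induction n rule: less_induct)
    case (less n)
    show ?case
    proof (cases n)
      case (Suc k)
      have "(\<Sum>i = 0..k. compinv f i * fps_nth (f ^ i) (Suc k)) \<in> \<int>"
        using less Suc int_series_power[OF f(2)]
        by (intro Ints_sum Ints_mult) (auto simp: int_series_def)
      then show ?thesis using f(1) Suc by (simp add: mem_D_real)
    qed simp
  qed
  then show ?thesis
    using D_real_inv(1)[OF f(1)] by (simp add: D_int_eq int_series_def fps_inv_def)
qed

text \<open>
  Every effect of changing one coefficient of a series is read off from this relation, which keeps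
  track of the first coefficient that moves and of the amount by which it moves.
\<close>

definition agree :: "nat \<Rightarrow> real \<Rightarrow> real fps \<Rightarrow> real fps \<Rightarrow> bool" where
  "agree n d f g \<longleftrightarrow> (\<forall>k<n. fps_nth g k = fps_nth f k) \<and> fps_nth g n = fps_nth f n + d"

lemma agree_below: "agree n d f g \<Longrightarrow> k < n \<Longrightarrow> fps_nth g k = fps_nth f k"
  by (simp add: agree_def)

lemma agree_at: "agree n d f g \<Longrightarrow> fps_nth g n = fps_nth f n + d"
  by (simp add: agree_def)

lemma agree_sym: "agree n d f g \<Longrightarrow> agree n (- d) g f"
  by (simp add: agree_def)

lemma compose_nth_cong:
  assumes "\<And>i. i \<le> n \<Longrightarrow> fps_nth f i = fps_nth g i"
  shows "fps_nth (f oo c) n = fps_nth (g oo c) n"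
  using assms by (simp add: fps_compose_nth)

text \<open>
  The difference of the outer series starts with \<open>d X\<^sup>n\<close>, and \<open>c\<^sup>n\<close> starts with \<open>X\<^sup>n\<close>.
\<close>

lemma agree_compose_left:
  assumes "agree n d f g" "c \<in> carrier D_real"
  shows "agree n d (f oo c) (g oo c)"
proof -
  have "fps_nth (g oo c) n = (\<Sum>i = 0..n. fps_nth f i * fps_nth (c ^ i) n + (if i = n then d else 0))"
    unfolding fps_compose_nth
  proof (rule sum.cong[OF refl])
    fix i assume "i \<in> {0..n}"
    then show "fps_nth g i * fps_nth (c ^ i) n = fps_nth f i * fps_nth (c ^ i) n + (if i = n then d else 0)"
      using assms startsby_zero_power_nth_same[of c n]
      by (cases "i = n") (auto simp: agree_def mem_D_real algebra_simps)
  qed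
  moreover have "fps_nth (g oo c) k = fps_nth (f oo c) k" if "k < n" for k
    using assms that by (intro compose_nth_cong) (auto simp: agree_def)
  ultimately show ?thesis
    by (simp add: agree_def sum.distrib fps_compose_nth)
qed

text \<open>
  The derivative of \<open>X\<^sup>i\<^sup>+\<^sup>1\<close> at a series that starts with \<open>X\<close>; by induction, from the product rule
  \<open>g\<^sup>i\<^sup>+\<^sup>2 - f\<^sup>i\<^sup>+\<^sup>2 = g (g\<^sup>i\<^sup>+\<^sup>1 - f\<^sup>i\<^sup>+\<^sup>1) + (g - f) f\<^sup>i\<^sup>+\<^sup>1\<close>.
\<close>

lemma agree_power:
  assumes "agree n d f g" "f \<in> carrier D_real" "g \<in> carrier D_real" "n \<ge> 2"
  shows "agree (n + i) (real (Suc i) * d) (f ^ Suc i) (g ^ Suc i)"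
proof (induction i)
  case (Suc i)
  let ?D = "g ^ Suc i - f ^ Suc i"
  have D: "fps_nth ?D k = 0" if "k < n + i" for k using Suc that by (simp add: agree_def)
  have Dn: "fps_nth ?D (n + i) = real (Suc i) * d" using Suc by (simp add: agree_def)
  have e: "fps_nth (g - f) k = 0" if "k < n" for k using assms(1) that by (simp add: agree_def)
  have en: "fps_nth (g - f) n = d" using assms(1) by (simp add: agree_def)
  have f0: "fps_nth (f ^ Suc i) k = 0" if "k < Suc i" for k
    using startsby_zero_power_prefix[of f "Suc i"] assms(2) that by (auto simp: mem_D_real)
  have f1: "fps_nth (f ^ Suc i) (Suc i) = 1"
    using startsby_zero_power_nth_same[of f "Suc i"] assms(2) by (auto simp: mem_D_real)
  have split: "g ^ Suc (Suc i) - f ^ Suc (Suc i) = g * ?D + (g - f) * f ^ Suc i"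
    by (simp add: algebra_simps)
  have g1: "fps_nth (g * ?D) k = (if k = Suc (n + i) then real (Suc i) * d else 0)" if kn: "k \<le> Suc (n + i)" for k
  proof -
    have "fps_nth (g * ?D) k = (\<Sum>j=0..k. if j = 1 \<and> k = Suc (n + i) then real (Suc i) * d else 0)"
      unfolding fps_mult_nth
    proof (rule sum.cong[OF refl])
      fix j assume j: "j \<in> {0..k}"
      consider "j = 0" | "j = 1" "k = Suc (n + i)" | "j \<ge> 1" "k - j < n + i"
        using j kn assms(4) by atomize_elim auto
      then show "fps_nth g j * fps_nth ?D (k - j) = (if j = 1 \<and> k = Suc (n + i) then real (Suc i) * d else 0)"
      proof cases
        case 2
        then show ?thesis using Dn assms(3) by (simp add: mem_D_real)
      next
        case 3
        moreover have "\<not> (j = 1 \<and> k = Suc (n + i))" using 3(2) by auto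
        ultimately show ?thesis using D by auto
      qed (use assms(3) in \<open>auto simp: mem_D_real\<close>)
    qed
    also have "\<dots> = (if k = Suc (n + i) then real (Suc i) * d else 0)" by auto
    finally show ?thesis .
  qed
  have g2: "fps_nth ((g - f) * f ^ Suc i) k = (if k = Suc (n + i) then d else 0)" if kn: "k \<le> Suc (n + i)" for k
  proof -
    have "fps_nth ((g - f) * f ^ Suc i) k = (\<Sum>j=0..k. if j = n \<and> k = Suc (n + i) then d else 0)"
      unfolding fps_mult_nth
    proof (rule sum.cong[OF refl])
      fix j assume j: "j \<in> {0..k}"
      consider "j < n" | "j = n" "k = Suc (n + i)" | "j \<ge> n" "k - j < Suc i"
        using j kn by atomize_elim auto
      then show "fps_nth (g - f) j * fps_nth (f ^ Suc i) (k - j) = (if j = n \<and> k = Suc (n + i) then d else 0)"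
      proof cases
        case 2
        then show ?thesis using en f1 by simp
      next
        case 3
        moreover have "\<not> (j = n \<and> k = Suc (n + i))" using 3(2) by auto
        ultimately show ?thesis using f0 by auto
      qed (use e in auto)
    qed
    also have "\<dots> = (if k = Suc (n + i) then d else 0)" by auto
    finally show ?thesis .
  qed
  have "fps_nth (g ^ Suc (Suc i) - f ^ Suc (Suc i)) k = (if k = Suc (n + i) then real (Suc (Suc i)) * d else 0)"
    if "k \<le> Suc (n + i)" for k
    unfolding split fps_add_nth g1[OF that] g2[OF that] by (simp add: algebra_simps)
  note * = this
  have "fps_nth (g ^ Suc (Suc i)) k = fps_nth (f ^ Suc (Suc i)) k" if "k < n + Suc i" for k
    using *[of k] that by (simp del: power_Suc)
  moreover have "fps_nth (g ^ Suc (Suc i)) (n + Suc i) = fps_nth (f ^ Suc (Suc i)) (n + Suc i) + real (Suc (Suc i)) * d"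
    using *[of "n + Suc i"] by (simp del: power_Suc add: algebra_simps)
  ultimately show ?case by (simp add: agree_def del: power_Suc)
qed (use assms(1) in simp)

text \<open>
  In \<open>c = c\<^sub>0 + c\<^sub>m\<^sub>+\<^sub>1 X\<^sup>m\<^sup>+\<^sup>1 + \<dots>\<close> a change of the inner series is first felt by the power
  \<open>X\<^sup>m\<^sup>+\<^sup>1\<close>, with the factor \<open>m + 1\<close> of its derivative; the higher powers feel it only later.
\<close>

lemma agree_compose_right:
  assumes "agree n d f g" "f \<in> carrier D_real" "g \<in> carrier D_real" "n \<ge> 2"
    and c: "\<And>i. 0 < i \<Longrightarrow> i < Suc m \<Longrightarrow> fps_nth c i = 0"
  shows "agree (n + m) (fps_nth c (Suc m) * real (Suc m) * d) (c oo f) (c oo g)"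
proof -
  have *: "fps_nth (c oo g) k - fps_nth (c oo f) k =
    (\<Sum>i=0..k. if i = Suc m \<and> k = n + m then fps_nth c (Suc m) * real (Suc m) * d else 0)"
    if "k \<le> n + m" for k
    unfolding fps_compose_nth sum_subtractf[symmetric]
  proof (rule sum.cong[OF refl])
    fix i assume i: "i \<in> {0..k}"
    consider "i = 0" | "0 < i" "i < Suc m" | "i = Suc m" | j where "i = Suc j" "m < j"
      by (metis Suc_less_eq bot_nat_0.not_eq_extremum linorder_neqE_nat old.nat.exhaust)
    then show "fps_nth c i * fps_nth (g ^ i) k - fps_nth c i * fps_nth (f ^ i) k =
      (if i = Suc m \<and> k = n + m then fps_nth c (Suc m) * real (Suc m) * d else 0)"
    proof cases
      case 3
      have "agree (n + m) (real (Suc m) * d) (f ^ Suc m) (g ^ Suc m)" by (rule agree_power) fact+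
      then show ?thesis using 3 that unfolding agree_def
        by (cases "k = n + m") (simp_all add: algebra_simps del: power_Suc)
    next
      case (4 j)
      have "agree (n + j) (real (Suc j) * d) (f ^ Suc j) (g ^ Suc j)" by (rule agree_power) fact+
      then show ?thesis using 4 that unfolding agree_def by (simp del: power_Suc)
    qed (use c in auto)
  qed
  have "(\<Sum>i=0..n + m. if i = Suc m then fps_nth c (Suc m) * real (Suc m) * d else 0)
      = fps_nth c (Suc m) * real (Suc m) * d"
    using assms(4) by (subst sum.delta) auto
  then have "fps_nth (c oo g) (n + m) = fps_nth (c oo f) (n + m) + fps_nth c (Suc m) * real (Suc m) * d"
    using *[of "n + m"] by simp
  moreover have "fps_nth (c oo g) k = fps_nth (c oo f) k" if "k < n + m" for k
    using *[of k] that by simp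
  ultimately show ?thesis by (simp add: agree_def)
qed

lemma agree_compose_right_D:
  assumes "agree n d f g" "f \<in> carrier D_real" "g \<in> carrier D_real" "n \<ge> 2" "c \<in> carrier D_real"
  shows "agree n d (c oo f) (c oo g)"
  using agree_compose_right[OF assms(1-4), of 0 c] assms(5) by (simp add: mem_D_real)

text \<open>
  Compare \<open>f\<^sup>-\<^sup>1 \<circ> f = X\<close> with \<open>f\<^sup>-\<^sup>1 \<circ> g\<close> and compose on the right with \<open>g\<^sup>-\<^sup>1\<close>.
\<close>

lemma agree_inv:
  assumes "agree n d f g" "f \<in> carrier D_real" "g \<in> carrier D_real" "n \<ge> 2"
  shows "agree n (- d) (fps_inv f) (fps_inv g)"
proof -
  have "agree n d (fps_inv f oo f) (fps_inv f oo g)"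
    using assms D_real_inv(1) by (intro agree_compose_right_D)
  then have "agree n d (fps_X oo fps_inv g) ((fps_inv f oo g) oo fps_inv g)"
    using assms D_real_inv by (intro agree_compose_left) auto
  also have "(fps_inv f oo g) oo fps_inv g = fps_inv f oo (g oo fps_inv g)"
    using assms D_real_inv by (intro D_real_comp_assoc) auto
  also have "\<dots> = fps_inv f" using assms D_real_inv by simp
  finally have "agree n d (fps_inv g) (fps_inv f)"
    using assms D_real_inv(1)[of g] by (simp add: mem_D_real)
  then show ?thesis by (rule agree_sym)
qed

section \<open>Coordinates on the group and on its quotient\<close>

text \<open>
  The coordinates start at the coefficient of \<open>X\<^sup>2\<close>, the first one that is free. This makes
  the group homeomorphic to a space of sequences, so that the topology and the measures of
  the type of sequences apply to it.
\<close>

definition ser :: "(nat \<Rightarrow> real) \<Rightarrow> real fps" where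
  "ser x = Abs_fps (\<lambda>n. if n = 0 then 0 else if n = 1 then 1 else x (n - 2))"

definition coords :: "real fps \<Rightarrow> nat \<Rightarrow> real" where
  "coords g k = fps_nth g (k + 2)"

lemma ser_nth: "fps_nth (ser x) n = (if n = 0 then 0 else if n = 1 then 1 else x (n - 2))"
  by (simp add: ser_def)

lemma ser_in_D_real [simp]: "ser x \<in> carrier D_real"
  by (simp add: mem_D_real ser_nth)

lemma coords_ser [simp]: "coords (ser x) = x"
  by (rule ext) (simp add: coords_def ser_nth)

lemma ser_coords: "g \<in> carrier D_real \<Longrightarrow> ser (coords g) = g"
proof (rule fps_ext)
  fix n :: nat assume "g \<in> carrier D_real"
  moreover have "n = 0 \<or> n = 1 \<or> n - 2 + 2 = n" by linarith
  ultimately show "fps_nth (ser (coords g)) n = fps_nth g n"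
    by (auto simp: mem_D_real ser_nth coords_def simp del: add_2_eq_Suc')
qed

lemma range_ser: "range ser = carrier D_real"
proof (intro equalityI subsetI)
  fix g assume "g \<in> carrier D_real"
  then have "g = ser (coords g)" by (simp add: ser_coords)
  then show "g \<in> range ser" by blast
qed auto

lemma agree_ser: "agree (j + 2) (t - x j) (ser x) (ser (x(j := t)))"
  by (auto simp: agree_def ser_nth)

definition coeff_continuous :: "('a::topological_space \<Rightarrow> real fps) \<Rightarrow> bool" where
  "coeff_continuous F \<longleftrightarrow> (\<forall>n. continuous_on UNIV (\<lambda>z. fps_nth (F z) n))"

definition coeff_measurable :: "'a measure \<Rightarrow> ('a \<Rightarrow> real fps) \<Rightarrow> bool" where
  "coeff_measurable M F \<longleftrightarrow> (\<forall>n. (\<lambda>z. fps_nth (F z) n) \<in> borel_measurable M)"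

lemma coeff_continuous_const: "coeff_continuous (\<lambda>_. c)"
  by (simp add: coeff_continuous_def)

lemma coeff_continuous_power:
  assumes "coeff_continuous F"
  shows "coeff_continuous (\<lambda>z. F z ^ i)"
proof (induction i)
  case (Suc i)
  then show ?case using assms
    by (auto simp: coeff_continuous_def fps_mult_nth intro!: continuous_intros)
qed (simp add: coeff_continuous_const)

lemma coeff_continuous_compose:
  assumes "coeff_continuous F" "coeff_continuous G"
  shows "coeff_continuous (\<lambda>z. F z oo G z)"
  using assms(1) coeff_continuous_power[OF assms(2)]
  by (auto simp: coeff_continuous_def fps_compose_nth intro!: continuous_intros)

lemma coeff_measurable_const: "coeff_measurable M (\<lambda>_. c)"
  by (simp add: coeff_measurable_def)

lemma coeff_measurable_power:
  assumes "coeff_measurable M F"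
  shows "coeff_measurable M (\<lambda>z. F z ^ i)"
proof (induction i)
  case (Suc i)
  then show ?case using assms by (auto simp: coeff_measurable_def fps_mult_nth intro!: borel_measurable_sum borel_measurable_times)
qed (simp add: coeff_measurable_const)

lemma coeff_measurable_compose:
  assumes "coeff_measurable M F" "coeff_measurable M G"
  shows "coeff_measurable M (\<lambda>z. F z oo G z)"
  using assms(1) coeff_measurable_power[OF assms(2)]
  by (auto simp: coeff_measurable_def fps_compose_nth intro!: borel_measurable_sum borel_measurable_times)

lemma coeff_measurable_inv:
  assumes "coeff_measurable M F" "\<And>z. F z \<in> carrier D_real"
  shows "coeff_measurable M (\<lambda>z. fps_inv (F z))"
proof -
  have "(\<lambda>z. compinv (F z) n) \<in> borel_measurable M" for n
  proof (induction n rule: less_induct)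
    case (less n)
    show ?case
    proof (cases n)
      case (Suc k)
      have e: "compinv (F z) (Suc k) = fps_nth fps_X (Suc k)
          - (\<Sum>i=0..k. compinv (F z) i * fps_nth (F z ^ i) (Suc k))" for z
        using assms(2)[of z] by (simp add: mem_D_real)
      have "(\<lambda>z. compinv (F z) i * fps_nth (F z ^ i) (Suc k)) \<in> borel_measurable M" if "i \<in> {0..k}" for i
      proof (rule borel_measurable_times)
        show "(\<lambda>z. compinv (F z) i) \<in> borel_measurable M" using that Suc by (intro less) simp
        show "(\<lambda>z. fps_nth (F z ^ i) (Suc k)) \<in> borel_measurable M"
          using coeff_measurable_power[OF assms(1), of i] by (simp add: coeff_measurable_def)
      qed
      then show ?thesis
        unfolding Suc e by (intro borel_measurable_diff borel_measurable_sum borel_measurable_const)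
    qed simp
  qed
  then show ?thesis by (simp add: coeff_measurable_def fps_inv_def)
qed

lemma coeff_continuous_ser: "coeff_continuous ser"
  unfolding coeff_continuous_def
proof
  fix n
  show "continuous_on UNIV (\<lambda>x. fps_nth (ser x) n)"
    by (cases "n = 0"; cases "n = 1") (simp_all add: ser_nth)
qed

lemma continuous_coords:
  assumes "coeff_continuous F"
  shows "continuous_on UNIV (\<lambda>z. coords (F z))"
  using assms by (intro continuous_on_coordinatewise_then_product) (auto simp: coords_def coeff_continuous_def)

lemma openin_D_top: "openin D_top U \<longleftrightarrow> U \<subseteq> carrier D_real \<and> open {x. ser x \<in> U}"
proof safe
  assume "openin D_top U"
  then obtain V where V: "open V" "U = fps_nth -` V \<inter> carrier D_real"
    by (auto simp: D_top_def openin_pullback_topology euclidean_product_topology)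
  then show "\<And>g. g \<in> U \<Longrightarrow> g \<in> carrier D_real" by blast
  have "continuous_on UNIV (\<lambda>x. fps_nth (ser x))"
    using coeff_continuous_ser
    by (intro continuous_on_coordinatewise_then_product) (auto simp: coeff_continuous_def)
  then have "open ((\<lambda>x. fps_nth (ser x)) -` V)" using V by (intro open_vimage)
  also have "(\<lambda>x. fps_nth (ser x)) -` V = {x. ser x \<in> U}" using V by auto
  finally show "open {x. ser x \<in> U}" .
next
  assume U: "U \<subseteq> carrier D_real" "open {x. ser x \<in> U}"
  let ?s = "\<lambda>(z :: nat \<Rightarrow> real) k. z (k + 2)"
  have "continuous_on UNIV ?s"
    by (intro continuous_on_coordinatewise_then_product continuous_on_product_coordinates)
  then have "open (?s -` {x. ser x \<in> U})" using U by (intro open_vimage)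
  moreover have "U = fps_nth -` (?s -` {x. ser x \<in> U}) \<inter> carrier D_real"
  proof -
    have "?s (fps_nth g) = coords g" for g by (auto simp: coords_def)
    then show ?thesis using U(1) ser_coords by auto
  qed
  ultimately show "openin D_top U"
    by (auto simp: D_top_def openin_pullback_topology euclidean_product_topology)
qed

lemma closedin_D_top: "closedin D_top F \<longleftrightarrow> F \<subseteq> carrier D_real \<and> closed {x. ser x \<in> F}"
proof -
  have "{x. ser x \<in> carrier D_real - F} = - {x. ser x \<in> F}" by auto
  then show ?thesis by (auto simp: closedin_def topspace_D_top openin_D_top closed_def)
qed

lemma D_proj_eq: "D_proj g = (\<lambda>h. g oo h) ` D_int"
  by (auto simp: D_proj_def l_coset_def)

lemma D_proj_eq_iff:
  assumes "g \<in> carrier D_real" "g' \<in> carrier D_real"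
  shows "D_proj g = D_proj g' \<longleftrightarrow> (\<exists>h\<in>D_int. g' = g oo h)"
proof
  assume "D_proj g = D_proj g'"
  moreover have "g' \<in> D_proj g'"
    unfolding D_proj_eq by (intro image_eqI[of _ _ fps_X])
      (auto simp: D_int_eq fps_X_in_D_real int_series_def fps_X_nth)
  ultimately show "\<exists>h\<in>D_int. g' = g oo h" by (auto simp: D_proj_eq)
next
  assume "\<exists>h\<in>D_int. g' = g oo h"
  then obtain h where h: "h \<in> D_int" "g' = g oo h" by auto
  then have hc: "h \<in> carrier D_real" by (simp add: D_int_eq)
  have 1: "g' oo k = g oo (h oo k)" if "k \<in> D_int" for k
    using that h hc by (simp add: D_int_eq D_real_comp_assoc)
  have 2: "g oo k = g' oo (fps_inv h oo k)" if "k \<in> D_int" for k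
  proof -
    have kc: "k \<in> carrier D_real" using that by (simp add: D_int_eq)
    have "g' oo (fps_inv h oo k) = g oo (h oo (fps_inv h oo k))"
      using kc hc h(2) by (simp add: D_real_comp_assoc D_real_comp D_real_inv)
    also have "h oo (fps_inv h oo k) = (h oo fps_inv h) oo k"
      using kc D_real_comp_assoc[of "fps_inv h" k h] D_real_inv(1)[OF hc] by simp
    also have "\<dots> = k" using kc hc by (simp add: D_real_inv mem_D_real)
    finally show ?thesis by simp
  qed
  show "D_proj g = D_proj g'"
    unfolding D_proj_eq
  proof (intro equalityI image_subsetI)
    fix k assume k: "k \<in> D_int"
    show "g oo k \<in> (\<lambda>h. g' oo h) ` D_int"
      using k h(1) by (intro image_eqI[where f = "\<lambda>h. g' oo h", OF 2] D_int_comp D_int_inv)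
    show "g' oo k \<in> (\<lambda>h. g oo h) ` D_int"
      using k h(1) by (intro image_eqI[where f = "\<lambda>h. g oo h", OF 1] D_int_comp)
  qed
qed

lemma act_D_proj:
  assumes "g \<in> carrier D_real" "c \<in> carrier D_real"
  shows "g <#\<^bsub>D_real\<^esub> D_proj c = D_proj (g oo c)"
proof -
  have "g oo (c oo h) = (g oo c) oo h" if "h \<in> D_int" for h
    using that assms by (simp add: D_int_eq D_real_comp_assoc)
  then show ?thesis by (auto simp: l_coset_def D_proj_eq)
qed

definition pt :: "(nat \<Rightarrow> real) \<Rightarrow> real fps set" where
  "pt x = D_proj (ser x)"

lemma range_pt: "range pt = D_proj ` carrier D_real"
  unfolding pt_def range_ser[symmetric] by auto

lemma topspace_D_quot: "topspace D_quot_top = range pt"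
  by (simp add: D_quot_top_def topspace_quotient_top topspace_D_top range_pt)

lemma openin_D_quot: "openin D_quot_top W \<longleftrightarrow> W \<subseteq> range pt \<and> open {x. pt x \<in> W}"
proof -
  have "{x. ser x \<in> {g \<in> carrier D_real. D_proj g \<in> W}} = {x. pt x \<in> W}" by (auto simp: pt_def)
  then show ?thesis
    by (auto simp: D_quot_top_def openin_quotient_top topspace_D_top openin_D_top range_pt)
qed

lemma closedin_D_quot: "closedin D_quot_top W \<longleftrightarrow> W \<subseteq> range pt \<and> closed {x. pt x \<in> W}"
proof -
  have "{x. pt x \<in> range pt - W} = - {x. pt x \<in> W}" by auto
  then show ?thesis by (auto simp: closedin_def topspace_D_quot openin_D_quot closed_def)
qed

text \<open>
  The preimage of the image of \<open>U\<close> is the union of the right translates of \<open>U\<close>, and right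
  translations are homeomorphisms.
\<close>

lemma open_image_pt:
  assumes "open U"
  shows "openin D_quot_top (pt ` U)"
proof -
  have "{x. pt x \<in> pt ` U} = (\<Union>h\<in>D_int. (\<lambda>x. coords (ser x oo h)) -` U)"
  proof (intro equalityI subsetI)
    fix x assume "x \<in> {x. pt x \<in> pt ` U}"
    then obtain u where u: "u \<in> U" "pt x = pt u" by auto
    then obtain h where h: "h \<in> D_int" "ser u = ser x oo h"
      by (auto simp: pt_def D_proj_eq_iff)
    then show "x \<in> (\<Union>h\<in>D_int. (\<lambda>x. coords (ser x oo h)) -` U)"
      using u h(1) by (auto intro!: bexI[of _ h] simp: h(2)[symmetric])
  next
    fix x assume "x \<in> (\<Union>h\<in>D_int. (\<lambda>x. coords (ser x oo h)) -` U)"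
    then obtain h where h: "h \<in> D_int" "coords (ser x oo h) \<in> U" by auto
    then have c: "ser x oo h \<in> carrier D_real" by (simp add: D_int_eq D_real_comp)
    then have "pt x = pt (coords (ser x oo h))"
      using h by (auto simp: pt_def D_proj_eq_iff ser_coords)
    then show "x \<in> {x. pt x \<in> pt ` U}" using h by blast
  qed
  moreover have "open ((\<lambda>x. coords (ser x oo h)) -` U)" for h
    by (intro open_vimage assms continuous_coords coeff_continuous_compose
        coeff_continuous_ser coeff_continuous_const)
  ultimately show ?thesis by (auto simp: openin_D_quot)
qed

lemma space_borel_sigma: "space (borel_sigma X) = topspace X"
  by (simp add: borel_sigma_def space_measure_of_conv)

lemma sets_borel_sigma: "sets (borel_sigma X) = sigma_sets (topspace X) {U. openin X U}"
  unfolding borel_sigma_def by (rule sets_measure_of) (auto dest: openin_subset)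

lemma open_in_borel_sigma: "openin X U \<Longrightarrow> U \<in> sets (borel_sigma X)"
  by (auto simp: sets_borel_sigma)

lemma closed_in_borel_sigma: "closedin X F \<Longrightarrow> F \<in> sets (borel_sigma X)"
  using sets.compl_sets[OF open_in_borel_sigma[of X "topspace X - F"]]
  by (auto simp: closedin_def space_borel_sigma double_diff)

lemma measurable_borel_sigmaI:
  assumes "\<And>x. x \<in> space M \<Longrightarrow> f x \<in> topspace X"
    and "\<And>U. openin X U \<Longrightarrow> f -` U \<inter> space M \<in> sets M"
  shows "f \<in> M \<rightarrow>\<^sub>M borel_sigma X"
  unfolding borel_sigma_def using assms
  by (intro measurable_measure_of) (auto dest: openin_subset)

lemma measurable_pt: "pt \<in> borel \<rightarrow>\<^sub>M borel_sigma D_quot_top"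
proof (rule measurable_borel_sigmaI)
  fix U assume "openin D_quot_top U"
  then have "open (pt -` U)" by (simp add: openin_D_quot vimage_def)
  then show "pt -` U \<inter> space borel \<in> sets borel" by simp
qed (simp add: topspace_D_quot)

text \<open>
  The preimage \<open>S\<close> of an open set is the union, over a countable base of the first factor, of the
  rectangles \<open>B \<times> V B\<close>, with \<open>V B\<close> the largest open set for which the rectangle fits in \<open>S\<close>. That
  these fill \<open>S\<close> follows from the continuity of composition, since the quotient map is open.
\<close>

lemma measurable_action:
  "(\<lambda>(x, C). ser x <#\<^bsub>D_real\<^esub> C) \<in> borel \<Otimes>\<^sub>M borel_sigma D_quot_top \<rightarrow>\<^sub>M borel_sigma D_quot_top"
proof (rule measurable_borel_sigmaI)
  fix z :: "(nat \<Rightarrow> real) \<times> real fps set"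
  assume "z \<in> space (borel \<Otimes>\<^sub>M borel_sigma D_quot_top)"
  then show "(case z of (x, C) \<Rightarrow> ser x <#\<^bsub>D_real\<^esub> C) \<in> topspace D_quot_top"
    by (auto simp: space_pair_measure space_borel_sigma topspace_D_quot range_pt
        act_D_proj D_real_comp)
next
  fix W assume W: "openin D_quot_top W"
  define S where "S = (\<lambda>(x, C). ser x <#\<^bsub>D_real\<^esub> C) -` W \<inter> space ((borel :: (nat \<Rightarrow> real) measure) \<Otimes>\<^sub>M borel_sigma D_quot_top)"
  obtain \<B> :: "(nat \<Rightarrow> real) set set" where \<B>: "countable \<B>" "topological_basis \<B>"
    using ex_countable_basis by auto
  define V where "V B = \<Union>{V. openin D_quot_top V \<and> B \<times> V \<subseteq> S}" for B
  have "S = (\<Union>B\<in>\<B>. B \<times> V B)"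
  proof (intro equalityI subsetI)
    fix z assume z: "z \<in> S"
    then obtain x y where xy: "z = (x, pt y)"
      by (auto simp: S_def space_pair_measure space_borel_sigma topspace_D_quot)
    define O' where "O' = {(x, y). pt (coords (ser x oo ser y)) \<in> W}"
    have Oiff: "(x, pt y) \<in> S \<longleftrightarrow> (x, y) \<in> O'" for x y
      by (auto simp: S_def O'_def space_pair_measure space_borel_sigma topspace_D_quot
          pt_def act_D_proj ser_coords D_real_comp)
    have c: "coeff_continuous (\<lambda>z. ser (fst z) oo ser (snd z))"
    proof (intro coeff_continuous_compose)
      show "coeff_continuous (\<lambda>z :: (nat \<Rightarrow> real) \<times> (nat \<Rightarrow> real). ser (fst z))"
        "coeff_continuous (\<lambda>z :: (nat \<Rightarrow> real) \<times> (nat \<Rightarrow> real). ser (snd z))"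
        using coeff_continuous_ser unfolding coeff_continuous_def
        by (auto intro: continuous_on_compose2[OF _ continuous_on_fst[OF continuous_on_id]]
            continuous_on_compose2[OF _ continuous_on_snd[OF continuous_on_id]])
    qed
    have "open ((\<lambda>z. coords (ser (fst z) oo ser (snd z))) -` {x. pt x \<in> W})"
      using W by (intro open_vimage continuous_coords c) (simp add: openin_D_quot)
    also have "(\<lambda>z. coords (ser (fst z) oo ser (snd z))) -` {x. pt x \<in> W} = O'"
      by (auto simp: O'_def)
    finally have "open O'" .
    moreover have "(x, y) \<in> O'" using z xy Oiff by simp
    ultimately obtain A U where AU: "open A" "open U" "x \<in> A" "y \<in> U" "A \<times> U \<subseteq> O'"
      by (auto elim!: open_prod_elim)
    then obtain B where B: "B \<in> \<B>" "x \<in> B" "B \<subseteq> A"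
      using \<B>(2) by (meson topological_basisE)
    have "B \<times> pt ` U \<subseteq> S" using AU(5) B(3) Oiff by auto
    then have "pt y \<in> V B" using open_image_pt[OF AU(2)] AU(4) by (auto simp: V_def)
    then show "z \<in> (\<Union>B\<in>\<B>. B \<times> V B)" using B xy by auto
  qed (auto simp: V_def)
  moreover have "B \<times> V B \<in> sets (borel \<Otimes>\<^sub>M borel_sigma D_quot_top)" if "B \<in> \<B>" for B
  proof -
    have "openin D_quot_top (V B)" unfolding V_def by (intro openin_Union) auto
    then show ?thesis using topological_basis_open[OF \<B>(2) that]
      by (intro pair_measureI open_in_borel_sigma) auto
  qed
  ultimately show "(\<lambda>(x, C). ser x <#\<^bsub>D_real\<^esub> C) -` W \<inter> space (borel \<Otimes>\<^sub>M borel_sigma D_quot_top)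
      \<in> sets (borel \<Otimes>\<^sub>M borel_sigma D_quot_top)"
    using \<B>(1) unfolding S_def[symmetric] by (auto intro!: sets.countable_UN')
qed

section \<open>Independent uniform coordinates\<close>

definition unif :: "real measure" where
  "unif = uniform_measure lborel {0..<1}"

abbreviation unif_seq :: "(nat \<Rightarrow> real) measure" where
  "unif_seq \<equiv> PiM UNIV (\<lambda>_. unif)"

lemma sets_unif [measurable_cong, simp]: "sets unif = sets borel"
  by (simp add: unif_def)

lemma space_unif [simp]: "space unif = UNIV"
  by (simp add: unif_def)

lemma emeasure_unif: "A \<in> sets borel \<Longrightarrow> emeasure unif A = emeasure lborel (A \<inter> {0..<1})"
  by (simp add: unif_def Int_commute divide_ennreal_def)

lemma prob_space_unif: "prob_space unif"
  unfolding unif_def by (rule prob_space_uniform_measure) auto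

interpretation unif: prob_space unif
  by (rule prob_space_unif)

interpretation unif_seq: product_prob_space "\<lambda>_::nat. unif" UNIV
  by unfold_locales

lemma sets_unif_seq: "sets unif_seq = sets borel"
  by (subst sets_PiM_equal_borel[symmetric]) (rule sets_PiM_cong, auto)

lemma space_unif_seq [simp]: "space unif_seq = UNIV"
  by (simp add: space_PiM)

lemma measurable_resample: "(\<lambda>(x, t). x(j := t)) \<in> unif_seq \<Otimes>\<^sub>M unif \<rightarrow>\<^sub>M unif_seq"
proof (rule measurable_PiM_single')
  fix i :: nat
  show "(\<lambda>z. (case z of (x, t) \<Rightarrow> x(j := t)) i) \<in> unif_seq \<Otimes>\<^sub>M unif \<rightarrow>\<^sub>M unif"
    by (cases "i = j") (auto simp: split_beta)
qed auto

text \<open>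
  All the uses of Fubini's theorem with respect to a single coordinate go through this fact. It
  allows the dependence of a function on a coordinate to be expressed by the effect of
  changing that coordinate, without splitting the product.
\<close>

lemma distr_resample: "distr (unif_seq \<Otimes>\<^sub>M unif) unif_seq (\<lambda>(x, t). x(j := t)) = unif_seq"
proof (rule unif_seq.PiM_eq)
  fix J :: "nat set" and F :: "nat \<Rightarrow> real set"
  assume J: "finite J" and F: "\<And>i. i \<in> J \<Longrightarrow> F i \<in> sets unif"
  define F' where "F' = (\<lambda>i. if i \<in> J then F i else UNIV)"
  have F': "F' i \<in> sets unif" for i using F by (simp add: F'_def)
  let ?E = "prod_emb UNIV (\<lambda>_. unif)"
  have E: "?E K (Pi\<^sub>E K F') = {x. \<forall>i\<in>K. x i \<in> F' i}" for K
    by (auto simp: prod_emb_def PiE_iff space_PiM)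
  have JE: "?E J (Pi\<^sub>E J F) = {x. \<forall>i\<in>insert j J. x i \<in> F' i}"
    by (auto simp: prod_emb_def PiE_iff space_PiM F'_def)
  have S: "?E K (Pi\<^sub>E K F') \<in> sets unif_seq" if "finite K" for K
    using that F' by (intro sets_PiM_I) auto
  have "emeasure (distr (unif_seq \<Otimes>\<^sub>M unif) unif_seq (\<lambda>(x, t). x(j := t))) (?E J (Pi\<^sub>E J F))
      = emeasure (unif_seq \<Otimes>\<^sub>M unif) ({x. \<forall>i\<in>J - {j}. x i \<in> F' i} \<times> F' j)"
    using S[of "insert j J"] J
    by (subst emeasure_distr[OF measurable_resample])
      (auto simp: JE E space_pair_measure intro!: arg_cong2[where f = emeasure] split: if_splits)
  also have "\<dots> = emeasure unif_seq {x. \<forall>i\<in>J - {j}. x i \<in> F' i} * emeasure unif (F' j)"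
    using S[of "J - {j}"] F' J by (intro unif.emeasure_pair_measure_Times) (auto simp: E)
  also have "emeasure unif_seq {x. \<forall>i\<in>J - {j}. x i \<in> F' i} = (\<Prod>i\<in>J - {j}. emeasure unif (F' i))"
    using J F' by (subst E[symmetric], subst unif_seq.emeasure_PiM_emb) auto
  also have "(\<Prod>i\<in>J - {j}. emeasure unif (F' i)) * emeasure unif (F' j) = (\<Prod>i\<in>insert j J. emeasure unif (F' i))"
    using J by (simp add: prod.insert_remove mult.commute)
  also have "\<dots> = (\<Prod>i\<in>J. emeasure unif (F' i))"
    using J unif.emeasure_space_1 by (cases "j \<in> J") (auto simp: insert_absorb F'_def)
  also have "\<dots> = (\<Prod>i\<in>J. emeasure unif (F i))" by (simp add: F'_def)
  finally show "emeasure (distr (unif_seq \<Otimes>\<^sub>M unif) unif_seq (\<lambda>(x, t). x(j := t))) (?E J (Pi\<^sub>E J F))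
      = (\<Prod>i\<in>J. emeasure unif (F i))" .
qed simp

lemma nn_integral_resample:
  assumes "f \<in> borel_measurable unif_seq"
  shows "(\<integral>\<^sup>+x. f x \<partial>unif_seq) = (\<integral>\<^sup>+x. \<integral>\<^sup>+t. f (x(j := t)) \<partial>unif \<partial>unif_seq)"
proof -
  note [measurable] = assms measurable_resample
  have "(\<integral>\<^sup>+x. f x \<partial>unif_seq) = (\<integral>\<^sup>+x. f x \<partial>distr (unif_seq \<Otimes>\<^sub>M unif) unif_seq (\<lambda>(x, t). x(j := t)))"
    by (simp only: distr_resample)
  also have "\<dots> = (\<integral>\<^sup>+z. f (case z of (x, t) \<Rightarrow> x(j := t)) \<partial>(unif_seq \<Otimes>\<^sub>M unif))"
    by (intro nn_integral_distr) auto
  also have "\<dots> = (\<integral>\<^sup>+x. \<integral>\<^sup>+t. f (x(j := t)) \<partial>unif \<partial>unif_seq)"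
    by (subst unif.nn_integral_fst[symmetric]) auto
  finally show ?thesis .
qed

lemma frac_borel_measurable: "(frac :: real \<Rightarrow> real) \<in> borel_measurable borel"
  unfolding frac_def[abs_def] by simp

text \<open>
  The rotation by \<open>s\<close> translates \<open>[0, 1 - frac s)\<close> onto \<open>[frac s, 1)\<close> and the rest of the interval
  onto \<open>[0, frac s)\<close>.
\<close>

lemma unif_rotation:
  assumes A: "A \<in> sets borel"
  shows "emeasure unif {t. frac (s + t) \<in> A} = emeasure unif A"
proof -
  define r where "r = frac s"
  have r: "0 \<le> r" "r < 1" by (simp_all add: r_def frac_lt_1)
  have fr: "frac (s + t) = (if t < 1 - r then t + r else t + r - 1)" if "0 \<le> t" "t < 1" for t
    using that frac_add[of s t] frac_eq[of t] by (auto simp: r_def)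
  note [measurable] = A frac_borel_measurable
  have S: "{t. frac (s + t) \<in> A} \<in> sets borel" by measurable
  have tr: "emeasure lborel {t. t + a \<in> B} = emeasure lborel B" if "B \<in> sets borel" for a and B :: "real set"
  proof -
    have "emeasure lborel B = emeasure (distr lborel borel ((+) a)) B"
      by (simp add: lborel_distr_plus)
    also have "\<dots> = emeasure lborel ((+) a -` B)" using that by (simp add: emeasure_distr)
    also have "(+) a -` B = {t. t + a \<in> B}" by (auto simp: add.commute)
    finally show ?thesis by simp
  qed
  have "{t. frac (s + t) \<in> A} \<inter> {0..<1} = {t. t + r \<in> A \<inter> {r..<1}} \<union> {t. t + (r - 1) \<in> A \<inter> {0..<r}}"
    (is "?L = ?R")
  proof (rule Set.set_eqI)
    fix t
    show "t \<in> ?L \<longleftrightarrow> t \<in> ?R"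
      using r fr[of t] by (cases "0 \<le> t \<and> t < 1") (auto simp: diff_add_eq add_diff_eq)
  qed
  then have "emeasure unif {t. frac (s + t) \<in> A}
      = emeasure lborel ({t. t + r \<in> A \<inter> {r..<1}} \<union> {t. t + (r - 1) \<in> A \<inter> {0..<r}})"
    using S by (simp add: emeasure_unif)
  also have "\<dots> = emeasure lborel {t. t + r \<in> A \<inter> {r..<1}} + emeasure lborel {t. t + (r - 1) \<in> A \<inter> {0..<r}}"
    by (rule plus_emeasure[symmetric]) (measurable, auto)
  also have "\<dots> = emeasure lborel (A \<inter> {r..<1}) + emeasure lborel (A \<inter> {0..<r})"
    by (simp only: tr[OF sets.Int[OF A atLeastLessThan_borel]])
  also have "\<dots> = emeasure lborel ((A \<inter> {r..<1}) \<union> (A \<inter> {0..<r}))"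
    by (rule plus_emeasure) (use A in auto)
  also have "(A \<inter> {r..<1}) \<union> (A \<inter> {0..<r}) = A \<inter> {0..<1}" using r by auto
  finally show ?thesis using A by (simp add: emeasure_unif)
qed

text \<open>
  The hypotheses describe a triangular system of rotations: the coordinate \<open>j\<close> of \<open>T x\<close> is \<open>x j\<close>,
  rotated by an angle that depends only on the earlier coordinates. Once these are fixed the
  rotation preserves the law of the last one, so the measures of boxes follow by induction on
  the number of coordinates.
\<close>

lemma distr_skew_rotation:
  assumes T: "T \<in> unif_seq \<rightarrow>\<^sub>M unif_seq"
    and below: "\<And>x j t k. k < j \<Longrightarrow> T (x(j := t)) k = T x k"
    and at: "\<And>x j t. T (x(j := t)) j = frac (T x j + (t - x j))"
  shows "distr unif_seq unif_seq T = unif_seq"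
proof (rule unif_seq.PiM_eq)
  note [measurable] = T
  have comp: "(\<lambda>x. T x i) \<in> unif_seq \<rightarrow>\<^sub>M borel" for i
    using measurable_compose[OF T measurable_component_singleton[of i UNIV "\<lambda>_. unif"]] by (simp add: measurable_cong_sets[OF refl sets_unif])
  have box: "emeasure unif_seq {x. \<forall>i<n. T x i \<in> A i} = (\<Prod>i<n. emeasure unif (A i))"
    if A: "\<And>i. A i \<in> sets borel" for A n
  proof (induction n)
    case 0
    then show ?case using unif_seq.emeasure_space_1 by simp
  next
    case (Suc n)
    note [measurable] = A comp
    let ?E = "{x. \<forall>i<n. T x i \<in> A i}"
    have m: "{x. \<forall>i<n. T x i \<in> A i} \<in> sets unif_seq" for n
    proof -
      have "{x \<in> space unif_seq. \<forall>i<n. T x i \<in> A i} \<in> sets unif_seq" by measurable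
      then show ?thesis by simp
    qed
    have "emeasure unif_seq {x. \<forall>i<Suc n. T x i \<in> A i}
        = (\<integral>\<^sup>+x. indicator {x. \<forall>i<Suc n. T x i \<in> A i} x \<partial>unif_seq)"
      using m by simp
    also have "\<dots> = (\<integral>\<^sup>+x. \<integral>\<^sup>+t. indicator {x. \<forall>i<Suc n. T x i \<in> A i} (x(n := t)) \<partial>unif \<partial>unif_seq)"
      using m by (intro nn_integral_resample) auto
    also have "\<dots> = (\<integral>\<^sup>+x. \<integral>\<^sup>+t. indicator ?E x * indicator {t. frac ((T x n - x n) + t) \<in> A n} t \<partial>unif \<partial>unif_seq)"
      by (intro nn_integral_cong) (auto simp: indicator_def less_Suc_eq below at algebra_simps)
    also have "\<dots> = (\<integral>\<^sup>+x. indicator ?E x * emeasure unif (A n) \<partial>unif_seq)"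
    proof (intro nn_integral_cong)
      fix x
      have "{t. frac ((T x n - x n) + t) \<in> A n} \<in> sets borel"
        using frac_borel_measurable by measurable
      then show "(\<integral>\<^sup>+t. indicator ?E x * indicator {t. frac ((T x n - x n) + t) \<in> A n} t \<partial>unif)
          = indicator ?E x * emeasure unif (A n)"
        by (simp add: nn_integral_cmult unif_rotation A)
    qed
    also have "\<dots> = emeasure unif_seq ?E * emeasure unif (A n)"
      using m by (simp add: nn_integral_multc)
    finally show ?case using Suc by (simp add: mult.commute)
  qed
  fix J :: "nat set" and F :: "nat \<Rightarrow> real set"
  assume J: "finite J" and F: "\<And>i. i \<in> J \<Longrightarrow> F i \<in> sets unif"
  define A where "A = (\<lambda>i. if i \<in> J then F i else UNIV)"
  have A: "A i \<in> sets borel" for i using F by (simp add: A_def)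
  obtain n where n: "J \<subseteq> {..<n}" using J by (meson finite_nat_iff_bounded)
  have "emeasure (distr unif_seq unif_seq T) (prod_emb UNIV (\<lambda>_. unif) J (Pi\<^sub>E J F))
      = emeasure unif_seq (T -` prod_emb UNIV (\<lambda>_. unif) J (Pi\<^sub>E J F))"
    using J F by (subst emeasure_distr) (auto intro!: sets_PiM_I)
  also have "T -` prod_emb UNIV (\<lambda>_. unif) J (Pi\<^sub>E J F) = {x. \<forall>i<n. T x i \<in> A i}"
    using n by (fastforce simp: prod_emb_def PiE_iff space_PiM A_def)
  also have "emeasure unif_seq \<dots> = (\<Prod>i<n. emeasure unif (A i))" by (rule box[OF A])
  also have "\<dots> = (\<Prod>i\<in>J. emeasure unif (A i))"
    using n unif.emeasure_space_1 by (intro prod.mono_neutral_right) (auto simp: A_def)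
  also have "\<dots> = (\<Prod>i\<in>J. emeasure unif (F i))" by (simp add: A_def)
  finally show "emeasure (distr unif_seq unif_seq T) (prod_emb UNIV (\<lambda>_. unif) J (Pi\<^sub>E J F))
      = (\<Prod>i\<in>J. emeasure unif (F i))" .
qed simp

section \<open>The invariant measure of the quotient\<close>

text \<open>
  Reduction modulo the right action: \<open>g = Y \<circ> H\<close>, with the coordinates of \<open>Y\<close> in \<open>[0, 1)\<close> and \<open>H\<close>
  integral, is solved one coefficient at a time, since the next coefficients of \<open>Y\<close> and of \<open>H\<close> enter
  the next coefficient of \<open>Y \<circ> H\<close> additively. The pair of truncations known at step \<open>k\<close> determines
  the defect whose fractional part goes to \<open>Y\<close> and whose integral part goes to \<open>H\<close>.
\<close>

fun reduction :: "real fps \<Rightarrow> nat \<Rightarrow> real fps \<times> real fps" where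
  "reduction g 0 = (fps_X, fps_X)"
| "reduction g (Suc k) =
    (let (y, h) = reduction g k; d = fps_nth g (k + 2) - fps_nth (y oo h) (k + 2)
     in (y + fps_const (frac d) * fps_X ^ (k + 2), h + fps_const (of_int \<lfloor>d\<rfloor>) * fps_X ^ (k + 2)))"

definition defect :: "real fps \<Rightarrow> nat \<Rightarrow> real" where
  "defect g k = fps_nth g (k + 2) - fps_nth (fst (reduction g k) oo snd (reduction g k)) (k + 2)"

definition frac_part :: "real fps \<Rightarrow> nat \<Rightarrow> real" where
  "frac_part g k = frac (defect g k)"

definition int_part :: "real fps \<Rightarrow> nat \<Rightarrow> real" where
  "int_part g k = of_int \<lfloor>defect g k\<rfloor>"

lemma reduction_Suc:
  "reduction g (Suc k) = (fst (reduction g k) + fps_const (frac_part g k) * fps_X ^ (k + 2),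
     snd (reduction g k) + fps_const (int_part g k) * fps_X ^ (k + 2))"
  by (simp add: Let_def split_beta frac_part_def int_part_def defect_def del: power_Suc add_2_eq_Suc')

declare reduction.simps(2) [simp del]

lemma reduction_nth:
  "fps_nth (fst (reduction g k)) n = (if n < k + 2 then fps_nth (ser (frac_part g)) n else 0)"
  "fps_nth (snd (reduction g k)) n = (if n < k + 2 then fps_nth (ser (int_part g)) n else 0)"
  by (induction k) (auto simp: reduction_Suc ser_nth not_less simp del: power_Suc add_2_eq_Suc'
      intro!: arg_cong[where f = "frac_part g"] arg_cong[where f = "int_part g"])

lemma int_part_in_D_int: "ser (int_part g) \<in> D_int"
  by (auto simp: D_int_eq int_series_def ser_nth int_part_def)

lemma ser_frac_part:
  assumes "g \<in> carrier D_real"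
  shows "ser (frac_part g) oo ser (int_part g) = g"
proof (rule fps_ext)
  fix n :: nat
  let ?Y = "ser (frac_part g)" and ?H = "ser (int_part g)"
  have c: "?Y oo ?H \<in> carrier D_real" by (intro D_real_comp ser_in_D_real)
  consider "n = 0" | "n = 1" | k where "n = k + 2"
    by (cases n; cases "n - 1") auto
  then show "fps_nth (?Y oo ?H) n = fps_nth g n"
  proof cases
    case (3 k)
    let ?y = "fst (reduction g k)" and ?h = "snd (reduction g k)"
    \<comment> \<open>Passing from the truncations to the full series adds first the coefficient of \<open>Y\<close>, then that of \<open>H\<close>.\<close>
    let ?Yk = "Abs_fps (\<lambda>i. if i < k + 2 then fps_nth ?Y i else 0)"
    let ?Hk = "Abs_fps (\<lambda>i. if i < k + 2 then fps_nth ?H i else 0)"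
    have D: "?Yk \<in> carrier D_real" "?Hk \<in> carrier D_real" by (auto simp: mem_D_real ser_nth)
    have red: "?Yk = ?y" "?Hk = ?h" by (rule fps_ext; simp add: reduction_nth)+
    have "agree (k + 2) (frac_part g k) ?Yk ?Y" "agree (k + 2) (int_part g k) ?Hk ?H"
      by (auto simp: agree_def ser_nth)
    then have "agree (k + 2) (int_part g k) (?Yk oo ?Hk) (?Yk oo ?H)"
      and "agree (k + 2) (frac_part g k) (?Yk oo ?H) (?Y oo ?H)"
      using D by (auto intro: agree_compose_right_D agree_compose_left)
    then have "fps_nth (?Y oo ?H) (k + 2) = fps_nth (?y oo ?h) (k + 2) + int_part g k + frac_part g k"
      using red by (simp add: agree_def)
    also have "\<dots> = fps_nth g (k + 2)"
      by (simp add: int_part_def frac_part_def frac_def) (simp add: defect_def)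
    finally show ?thesis using 3 by simp
  qed (use c assms in \<open>auto simp: mem_D_real\<close>)
qed

lemma pt_frac_part:
  assumes "g \<in> carrier D_real"
  shows "pt (frac_part g) = D_proj g"
  unfolding pt_def using assms ser_frac_part[OF assms] int_part_in_D_int
  by (subst D_proj_eq_iff) (auto intro!: bexI[of _ "ser (int_part g)"])

lemma reduction_cong:
  assumes "\<And>i. i < k + 2 \<Longrightarrow> fps_nth g' i = fps_nth g i"
  shows "reduction g' k = reduction g k"
  using assms
proof (induction k)
  case (Suc k)
  then have "reduction g' k = reduction g k" "fps_nth g' (k + 2) = fps_nth g (k + 2)" by auto
  then show ?case by (simp add: reduction_Suc frac_part_def int_part_def defect_def)
qed simp

lemma frac_part_agree:
  assumes "agree (j + 2) d g g'"
  shows "k < j \<Longrightarrow> frac_part g' k = frac_part g k" "frac_part g' j = frac (frac_part g j + d)"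
proof -
  have red: "reduction g' k = reduction g k" if "k \<le> j" for k
    using assms that by (intro reduction_cong) (auto simp: agree_def)
  show "frac_part g' k = frac_part g k" if "k < j"
    using red[of k] assms that by (simp add: frac_part_def defect_def agree_def)
  have "defect g' j = defect g j + d"
    using red[of j] assms by (simp add: defect_def agree_def)
  moreover have "frac (defect g j + d) = frac (frac (defect g j) + d)" by simp
  ultimately show "frac_part g' j = frac (frac_part g j + d)" by (simp add: frac_part_def)
qed

lemma measurable_frac_part:
  assumes "coeff_measurable M F"
  shows "(\<lambda>z. frac_part (F z)) \<in> M \<rightarrow>\<^sub>M unif_seq"
proof -
  have *: "coeff_measurable M (\<lambda>z. fst (reduction (F z) k)) \<and> coeff_measurable M (\<lambda>z. snd (reduction (F z) k))
      \<and> (\<lambda>z. defect (F z) k) \<in> borel_measurable M" for k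
  proof (induction k)
    case 0
    have "(\<lambda>z. defect (F z) 0) \<in> borel_measurable M"
      using assms by (simp add: defect_def coeff_measurable_def)
    then show ?case by (simp add: coeff_measurable_const)
  next
    case (Suc k)
    then have "(\<lambda>z. frac_part (F z) k) \<in> borel_measurable M" "(\<lambda>z. int_part (F z) k) \<in> borel_measurable M"
      using frac_borel_measurable by (auto simp: frac_part_def int_part_def)
    then have 1: "coeff_measurable M (\<lambda>z. fst (reduction (F z) (Suc k)))" "coeff_measurable M (\<lambda>z. snd (reduction (F z) (Suc k)))"
      using Suc by (auto simp: reduction_Suc coeff_measurable_def simp del: power_Suc add_2_eq_Suc'
          intro!: borel_measurable_add)
    have "(\<lambda>z. defect (F z) (Suc k)) \<in> borel_measurable M"
      using coeff_measurable_compose[OF 1] assms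
      by (auto simp: defect_def coeff_measurable_def intro!: borel_measurable_diff)
    with 1 show ?case by blast
  qed
  have "(\<lambda>z. frac_part (F z) k) \<in> borel_measurable M" for k
    using *[of k] frac_borel_measurable by (auto simp: frac_part_def)
  then show ?thesis by (intro measurable_PiM_single') (auto simp: measurable_cong_sets[OF refl sets_unif])
qed

lemma measurable_unif_seq: "borel_measurable unif_seq = borel_measurable borel"
  by (rule measurable_cong_sets) (auto simp: sets_unif_seq)

lemma measurable_pt_unif_seq: "pt \<in> unif_seq \<rightarrow>\<^sub>M borel_sigma D_quot_top"
  using measurable_pt measurable_cong_sets[OF sets_unif_seq refl] by blast

lemma coeff_measurable_ser: "coeff_measurable unif_seq ser"
  unfolding coeff_measurable_def
proof
  fix n
  have "(\<lambda>x. fps_nth (ser x) n) \<in> borel_measurable borel"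
    using coeff_continuous_ser by (intro borel_measurable_continuous_onI) (simp add: coeff_continuous_def)
  then show "(\<lambda>x. fps_nth (ser x) n) \<in> borel_measurable unif_seq" by (simp add: measurable_unif_seq)
qed

definition quot_measure :: "real fps set measure" where
  "quot_measure = distr unif_seq (borel_sigma D_quot_top) pt"

text \<open>
  The reduction of a random translate is a triangular system of rotations, because composition
  with \<open>g\<close> and with \<open>c\<close> adds to each coefficient a function of the earlier ones. The left factor
  gives the invariance of the measure, the right factor its uniqueness.
\<close>

lemma translate_law:
  assumes "g \<in> carrier D_real" "c \<in> carrier D_real" "A \<in> sets (borel_sigma D_quot_top)"
  shows "emeasure unif_seq {x. D_proj (g oo ser x oo c) \<in> A} = emeasure quot_measure A"
proof -
  let ?F = "\<lambda>x. g oo ser x oo c"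
  have F: "?F x \<in> carrier D_real" for x using assms by (intro D_real_comp ser_in_D_real)
  have m: "(\<lambda>x. frac_part (?F x)) \<in> unif_seq \<rightarrow>\<^sub>M unif_seq"
    by (intro measurable_frac_part coeff_measurable_compose coeff_measurable_const coeff_measurable_ser)
  have ag: "agree (j + 2) (t - x j) (?F x) (?F (x(j := t)))" for j t x
    using assms by (intro agree_compose_left agree_compose_right_D agree_ser ser_in_D_real) auto
  have d: "distr unif_seq unif_seq (\<lambda>x. frac_part (?F x)) = unif_seq"
    by (rule distr_skew_rotation[OF m]) (rule frac_part_agree[OF ag], assumption, rule frac_part_agree[OF ag])
  have "emeasure quot_measure A = emeasure unif_seq (pt -` A)"
    using measurable_pt_unif_seq assms by (simp add: quot_measure_def emeasure_distr)
  also have "\<dots> = emeasure (distr unif_seq unif_seq (\<lambda>x. frac_part (?F x))) (pt -` A)" by (simp only: d)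
  also have "\<dots> = emeasure unif_seq ((\<lambda>x. frac_part (?F x)) -` (pt -` A))"
    using measurable_sets[OF measurable_pt_unif_seq assms(3)] m by (simp add: emeasure_distr)
  also have "(\<lambda>x. frac_part (?F x)) -` (pt -` A) = {x. D_proj (?F x) \<in> A}"
    using pt_frac_part[OF F] by auto
  finally show ?thesis by simp
qed

lemma left_translate_eq:
  assumes "g \<in> carrier D_real" "A \<subseteq> range pt"
  shows "(\<lambda>C. g <#\<^bsub>D_real\<^esub> C) ` A = {C \<in> range pt. fps_inv g <#\<^bsub>D_real\<^esub> C \<in> A}"
proof -
  note inv = D_real_inv[OF assms(1)]
  have act: "g <#\<^bsub>D_real\<^esub> pt x = pt (coords (g oo ser x))" if "g \<in> carrier D_real" for g x
    using that by (simp add: pt_def act_D_proj ser_coords D_real_comp)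
  have 1: "fps_inv g <#\<^bsub>D_real\<^esub> (g <#\<^bsub>D_real\<^esub> pt x) = pt x" for x
    using assms(1) inv D_real_comp_assoc[of g "ser x" "fps_inv g"]
    by (simp add: act ser_coords D_real_comp ser_nth flip: D_real_comp_assoc)
  have 2: "g <#\<^bsub>D_real\<^esub> (fps_inv g <#\<^bsub>D_real\<^esub> pt x) = pt x" for x
    using assms(1) inv D_real_comp_assoc[of "fps_inv g" "ser x" g]
    by (simp add: act ser_coords D_real_comp ser_nth flip: D_real_comp_assoc)
  show ?thesis
  proof (intro equalityI subsetI)
    fix C assume "C \<in> (\<lambda>C. g <#\<^bsub>D_real\<^esub> C) ` A"
    then obtain x where "pt x \<in> A" "C = g <#\<^bsub>D_real\<^esub> pt x" using assms(2) by blast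
    then show "C \<in> {C \<in> range pt. fps_inv g <#\<^bsub>D_real\<^esub> C \<in> A}"
      using 1 act[OF assms(1)] by auto
  next
    fix C assume "C \<in> {C \<in> range pt. fps_inv g <#\<^bsub>D_real\<^esub> C \<in> A}"
    then show "C \<in> (\<lambda>C. g <#\<^bsub>D_real\<^esub> C) ` A" using 2 by (metis (no_types, lifting) imageE imageI mem_Collect_eq)
  qed
qed

lemma measurable_left_translate:
  assumes "g \<in> carrier D_real"
  shows "(\<lambda>C. g <#\<^bsub>D_real\<^esub> C) \<in> borel_sigma D_quot_top \<rightarrow>\<^sub>M borel_sigma D_quot_top"
  using measurable_compose[OF measurable_Pair1' measurable_action, of "coords g"]
  by (simp add: ser_coords assms)

lemma sets_left_translate:
  assumes "g \<in> carrier D_real" "A \<in> sets (borel_sigma D_quot_top)"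
  shows "(\<lambda>C. g <#\<^bsub>D_real\<^esub> C) ` A \<in> sets (borel_sigma D_quot_top)"
proof -
  have "A \<subseteq> range pt"
    using sets.sets_into_space[OF assms(2)] by (simp add: space_borel_sigma topspace_D_quot)
  then have "(\<lambda>C. g <#\<^bsub>D_real\<^esub> C) ` A
      = (\<lambda>C. fps_inv g <#\<^bsub>D_real\<^esub> C) -` A \<inter> space (borel_sigma D_quot_top)"
    by (auto simp: left_translate_eq[OF assms(1)] space_borel_sigma topspace_D_quot)
  then show ?thesis
    using measurable_sets[OF measurable_left_translate[OF D_real_inv(1)[OF assms(1)]] assms(2)] by simp
qed

lemma prob_space_quot_measure: "prob_space quot_measure"
  unfolding quot_measure_def
  by (rule unif_seq.prob_space_distr) (rule measurable_pt_unif_seq)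

lemma invariant_quot_measure: "invariant_prob quot_measure"
  unfolding invariant_prob_def
proof (intro conjI ballI)
  show "prob_space quot_measure" by (rule prob_space_quot_measure)
  show "sets quot_measure = sets (borel_sigma D_quot_top)" by (simp add: quot_measure_def)
  fix g A assume g: "g \<in> carrier D_real" and "A \<in> sets quot_measure"
  then have A: "A \<in> sets (borel_sigma D_quot_top)" by (simp add: quot_measure_def)
  have "A \<subseteq> range pt"
    using sets.sets_into_space[OF A] by (simp add: space_borel_sigma topspace_D_quot)
  then have "pt -` ((\<lambda>C. g <#\<^bsub>D_real\<^esub> C) ` A) = {x. D_proj (fps_inv g oo ser x oo fps_X) \<in> A}"
    using D_real_inv[OF g] by (auto simp: left_translate_eq[OF g] pt_def act_D_proj)
  then have "emeasure quot_measure ((\<lambda>C. g <#\<^bsub>D_real\<^esub> C) ` A)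
      = emeasure unif_seq {x. D_proj (fps_inv g oo ser x oo fps_X) \<in> A}"
    using measurable_pt_unif_seq sets_left_translate[OF g A] by (simp add: quot_measure_def emeasure_distr)
  also have "\<dots> = emeasure quot_measure A"
    using D_real_inv[OF g] A by (intro translate_law fps_X_in_D_real) auto
  finally show "emeasure quot_measure ((\<lambda>C. g <#\<^bsub>D_real\<^esub> C) ` A) = emeasure quot_measure A" .
qed

text \<open>
  Average the invariance of \<open>M\<close> under \<open>ser x\<close> over uniform \<open>x\<close> and exchange the integrals. For each
  fixed class the inner integral is then the law of the class of a random translate, which is
  the same for all classes.
\<close>

lemma invariant_prob_unique:
  assumes "invariant_prob M"
  shows "M = quot_measure"
proof (rule measure_eqI)
  have sM: "sets M = sets (borel_sigma D_quot_top)" using assms by (simp add: invariant_prob_def)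
  show "sets M = sets quot_measure" by (simp add: sM quot_measure_def)
  interpret M: prob_space M using assms by (simp add: invariant_prob_def)
  have spM: "space M = range pt"
    using sets_eq_imp_space_eq[OF sM] by (simp add: space_borel_sigma topspace_D_quot)
  fix A assume "A \<in> sets M"
  then have A: "A \<in> sets (borel_sigma D_quot_top)" by (simp add: sM)
  have AR: "A \<subseteq> range pt"
    using sets.sets_into_space[OF A] by (simp add: space_borel_sigma topspace_D_quot)
  define S where "S = {z \<in> space (unif_seq \<Otimes>\<^sub>M M). ser (fst z) <#\<^bsub>D_real\<^esub> snd z \<in> A}"
  have S: "S \<in> sets (unif_seq \<Otimes>\<^sub>M M)"
  proof -
    have "(\<lambda>(x, C). ser x <#\<^bsub>D_real\<^esub> C) \<in> unif_seq \<Otimes>\<^sub>M M \<rightarrow>\<^sub>M borel_sigma D_quot_top"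
      using measurable_action measurable_cong_sets[OF sets_pair_measure_cong[OF sets_unif_seq sM] refl]
      by blast
    from measurable_sets[OF this A] show ?thesis
      by (simp add: S_def vimage_def Collect_conj_eq Int_commute split_beta)
  qed
  \<comment> \<open>The set on the right is the translate of \<open>A\<close> by the inverse of \<open>ser x\<close>.\<close>
  have "emeasure M A = emeasure M {C \<in> range pt. ser x <#\<^bsub>D_real\<^esub> C \<in> A}" for x
  proof -
    have inv: "fps_inv (ser x) \<in> carrier D_real" "fps_inv (fps_inv (ser x)) = ser x"
      using D_real_inv(1)[of "ser x"] fps_inv_idempotent[of "ser x"] by (auto simp: ser_nth)
    have "emeasure M ((\<lambda>C. fps_inv (ser x) <#\<^bsub>D_real\<^esub> C) ` A) = emeasure M A"
      using assms inv(1) \<open>A \<in> sets M\<close> by (simp add: invariant_prob_def)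
    then show ?thesis using left_translate_eq[OF inv(1) AR] inv(2) by simp
  qed
  then have "emeasure M A = (\<integral>\<^sup>+x. emeasure M {C \<in> range pt. ser x <#\<^bsub>D_real\<^esub> C \<in> A} \<partial>unif_seq)"
    using unif_seq.emeasure_space_1 by (metis (no_types, lifting) mult.right_neutral nn_integral_cong nn_integral_const)
  also have "\<dots> = (\<integral>\<^sup>+x. emeasure M (Pair x -` S) \<partial>unif_seq)"
    by (intro nn_integral_cong arg_cong2[where f = emeasure]) (auto simp: S_def space_pair_measure spM)
  also have "\<dots> = emeasure (unif_seq \<Otimes>\<^sub>M M) S"
    using S by (rule M.emeasure_pair_measure_alt[symmetric])
  also have "\<dots> = (\<integral>\<^sup>+C. emeasure unif_seq ((\<lambda>x. (x, C)) -` S) \<partial>M)"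
  proof -
    interpret pair_sigma_finite unif_seq M ..
    show ?thesis using S by (rule emeasure_pair_measure_alt2)
  qed
  also have "\<dots> = (\<integral>\<^sup>+C. emeasure quot_measure A \<partial>M)"
  proof (rule nn_integral_cong)
    fix C assume "C \<in> space M"
    then obtain y where y: "C = pt y" using spM by auto
    have "(\<lambda>x. (x, C)) -` S = {x. D_proj (fps_X oo ser x oo ser y) \<in> A}"
      using y by (auto simp: S_def space_pair_measure spM pt_def act_D_proj mem_D_real[of "ser _"] ser_nth)
    also have "emeasure unif_seq \<dots> = emeasure quot_measure A"
      by (intro translate_law fps_X_in_D_real ser_in_D_real A)
    finally show "emeasure unif_seq ((\<lambda>x. (x, C)) -` S) = emeasure quot_measure A" .
  qed
  also have "\<dots> = emeasure quot_measure A" using M.emeasure_space_1 by simp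
  finally show "emeasure M A = emeasure quot_measure A" .
qed

lemma D_quot_measure_eq: "D_quot_measure = quot_measure"
  unfolding D_quot_measure_def
  by (rule the_equality) (fact invariant_quot_measure, fact invariant_prob_unique)

section \<open>The series with a nonconstant regular function\<close>

lemma closed_compact_projection_left:
  fixes K :: "'a::topological_space set" and Z :: "('a \<times> 'b::topological_space) set"
  assumes "compact K" "closed Z"
  shows "closed {y. \<exists>x\<in>K. (x, y) \<in> Z}"
proof -
  have "compact_space (top_of_set K)"
    using assms(1) by (simp add: compact_space_subtopology compactin_euclidean_iff)
  then have "closed_map (prod_topology (top_of_set K) (euclidean :: 'b topology)) euclidean snd"
    by (rule Abstract_Topological_Spaces.closed_map_snd)
  moreover have "closedin (prod_topology (top_of_set K) (euclidean :: 'b topology)) (Z \<inter> K \<times> UNIV)"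
  proof -
    have "prod_topology (top_of_set K) (euclidean :: 'b topology) = top_of_set (K \<times> UNIV)"
      using prod_topology_subtopology_eu[of K "UNIV :: 'b set"] by simp
    moreover have "closedin (top_of_set (K \<times> UNIV)) (K \<times> UNIV \<inter> Z)"
      using assms(2) by (rule closedin_closed_Int)
    ultimately show ?thesis by (simp add: Int_commute)
  qed
  ultimately have "closedin euclidean (snd ` (Z \<inter> K \<times> UNIV))"
    unfolding closed_map_def by blast
  moreover have "snd ` (Z \<inter> K \<times> UNIV) = {y. \<exists>x\<in>K. (x, y) \<in> Z}" by force
  ultimately show ?thesis by simp
qed

lemma compact_box: "compact {f :: nat \<Rightarrow> real. \<forall>k. \<bar>f k\<bar> \<le> B k}"
proof -
  have "compactin (product_topology (\<lambda>_. euclidean) UNIV) (PiE UNIV (\<lambda>k. {- B k..B k}))"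
    by (simp add: compactin_PiE compactin_euclidean_iff)
  moreover have "PiE UNIV (\<lambda>k. {- B k..B k}) = {f. \<forall>k. \<bar>f k\<bar> \<le> B k}"
    by (auto simp: PiE_iff abs_le_iff minus_le_iff[of "B k" for k])
  ultimately show ?thesis by (simp add: euclidean_product_topology compactin_euclidean_iff)
qed

text \<open>
  One index serves for the constant and for the rate, so that countably many bounds exhaust all
  radii of convergence above \<open>1\<close>.
\<close>

definition geometric_bound :: "nat \<Rightarrow> nat \<Rightarrow> real" where
  "geometric_bound n k = real (n + 1) * (1 - 1 / real (n + 2)) ^ k"

lemma geometric_bound_tendsto: "geometric_bound n \<longlonglongrightarrow> 0"
proof -
  have "(\<lambda>k. (1 - 1 / real (n + 2)) ^ k) \<longlonglongrightarrow> 0"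
    by (rule LIMSEQ_power_zero) (simp add: field_simps)
  from tendsto_mult_right_zero[OF this, of "real (n + 1)"] show ?thesis
    by (simp add: geometric_bound_def[abs_def])
qed

text \<open>
  The bound holds for all large indices, and not just for one, so that the index can also be
  chosen large enough to witness that \<open>f\<close> is not constant.
\<close>

lemma conv_radius_gt_1_imp_bound:
  fixes f :: "real fps"
  assumes "fps_conv_radius f > 1"
  obtains N where "\<And>n k. n \<ge> N \<Longrightarrow> \<bar>fps_nth f k\<bar> \<le> geometric_bound n k"
proof -
  obtain R :: real where R: "1 < R" "ereal R < fps_conv_radius f"
    using ereal_dense2[OF assms] by auto
  then have "summable (\<lambda>k. fps_nth f k * R ^ k)"
    by (intro summable_in_conv_radius) (auto simp: fps_conv_radius_def)
  then have "Bseq (\<lambda>k. fps_nth f k * R ^ k)"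
    by (intro convergent_imp_Bseq convergentI[OF summable_LIMSEQ_zero])
  then obtain C where C: "\<bar>fps_nth f k * R ^ k\<bar> \<le> C" for k by (auto simp: Bseq_def)
  obtain N1 where N1: "C \<le> real N1" using real_arch_simple by blast
  obtain N2 where N2: "1 / (1 - 1 / R) \<le> real N2" using real_arch_simple by blast
  have "\<bar>fps_nth f k\<bar> \<le> geometric_bound n k" if n: "n \<ge> max N1 N2" for n k
  proof -
    have r: "1 / R \<le> 1 - 1 / real (n + 2)"
    proof -
      have "1 / (1 - 1 / R) \<le> real (n + 2)" using N2 n by simp
      then show ?thesis using R(1) by (simp add: field_simps)
    qed
    have "\<bar>fps_nth f k\<bar> = \<bar>fps_nth f k * R ^ k\<bar> * (1 / R) ^ k"
      using R(1) by (simp add: abs_mult field_simps)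
    also have "\<dots> \<le> real (n + 1) * (1 - 1 / real (n + 2)) ^ k"
      using C[of k] N1 n r R(1) by (intro mult_mono power_mono) auto
    finally show ?thesis by (simp add: geometric_bound_def)
  qed
  then show ?thesis by (rule that)
qed

lemma bound_imp_conv_radius_gt_1:
  fixes f :: "real fps"
  assumes "\<And>k. \<bar>fps_nth f k\<bar> \<le> geometric_bound n k"
  shows "fps_conv_radius f > 1"
proof -
  define q where "q = 1 - 1 / real (n + 2)"
  have q: "0 < q" "q < 1" by (simp_all add: q_def field_simps)
  obtain z where z: "1 < z" "z < 1 / q" using dense[of 1 "1 / q"] q by (auto simp: field_simps)
  have "summable (\<lambda>k. real (n + 1) * (q * z) ^ k)"
    using q z by (intro summable_mult summable_geometric) (simp add: field_simps)
  then have "summable (\<lambda>k. fps_nth f k * z ^ k)"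
  proof (rule summable_comparison_test')
    fix k
    have "norm (fps_nth f k * z ^ k) = \<bar>fps_nth f k\<bar> * z ^ k"
      using z(1) by (simp add: abs_mult)
    also have "\<dots> \<le> geometric_bound n k * z ^ k"
      using assms[of k] z(1) by (intro mult_right_mono) auto
    also have "\<dots> = real (n + 1) * (q * z) ^ k"
      by (simp only: geometric_bound_def q_def power_mult_distrib mult.assoc)
    finally show "norm (fps_nth f k * z ^ k) \<le> real (n + 1) * (q * z) ^ k" .
  qed
  then have "ereal (norm z) \<le> fps_conv_radius f"
    unfolding fps_conv_radius_def by (rule conv_radius_geI)
  moreover have "1 < ereal (norm z)" using z(1) by simp
  ultimately show ?thesis by (rule less_le_trans[rotated])
qed

lemma compose_homothety_nth: "fps_nth (f oo homothety l) n = l ^ n * fps_nth f n"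
proof -
  have "homothety l ^ i = fps_const (l ^ i) * fps_X ^ i" for i
    by (simp add: homothety_def power_mult_distrib fps_const_power)
  then show ?thesis
    by (simp add: fps_compose_nth if_distrib cong: if_cong)
qed

lemma homothety_0: "fps_nth (homothety l) 0 = 0"
  by (simp add: homothety_def)

text \<open>
  Whether a nonconstant regular function exists is expressed through the analytic function \<open>f\<close> on
  the disk, because \<open>f\<close>, unlike the integral series that it induces, ranges over a compact set.
  The first condition on \<open>f\<close> controls its radius of convergence and the second one, a closed
  condition, keeps it away from the constants. The latter is put on \<open>f\<close> rather than on the integral
  series, whose individual coefficients can vanish after a right translation of \<open>g\<close>.
\<close>

definition bad_series :: "real \<Rightarrow> nat \<Rightarrow> nat \<Rightarrow> real fps set" where
  "bad_series l n j = {g \<in> carrier D_real. \<exists>f. (\<forall>k. \<bar>fps_nth f k\<bar> \<le> geometric_bound n k) \<and>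
     \<bar>fps_nth f (Suc j)\<bar> \<ge> 1 / real (n + 1) \<and> f oo (homothety l oo g) \<in> int_series}"

lemma fps_of_int_const: "fps_of_int (fps_const c) = fps_const (of_int c)"
  by (rule fps_ext) (simp add: fps_of_int_def)

lemma fps_nonconst_iff: "f \<notin> range fps_const \<longleftrightarrow> (\<exists>j. fps_nth f (Suc j) \<noteq> 0)"
proof
  show "\<exists>j. fps_nth f (Suc j) \<noteq> 0" if "f \<notin> range fps_const"
  proof (rule ccontr)
    assume "\<not> ?thesis"
    then have "fps_nth f n = fps_nth (fps_const (fps_nth f 0)) n" for n
      by (cases n) auto
    then have "f = fps_const (fps_nth f 0)" by (rule fps_ext)
    with that show False by blast
  qed
qed auto

lemma T_set_eq:
  assumes "l \<noteq> 0"
  shows "T_set l = carrier D_real - (\<Union>(n, j)\<in>UNIV. bad_series l n j)"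
proof -
  have "regular_functions (homothety l oo g) \<noteq> range fps_const \<longleftrightarrow> (\<exists>n j. g \<in> bad_series l n j)"
    if g: "g \<in> carrier D_real" for g
  proof -
    define \<psi> where "\<psi> = homothety l oo g"
    have \<psi>0: "fps_nth \<psi> 0 = 0" by (simp add: \<psi>_def homothety_0)
    have \<psi>1: "fps_nth \<psi> 1 \<noteq> 0"
      using D_group_comp_nth_1[of g "homothety l"] g assms
      by (simp add: \<psi>_def mem_D_real homothety_def)
    have \<psi>i: "fps_inv \<psi> oo \<psi> = fps_X" "\<psi> oo fps_inv \<psi> = fps_X" "fps_nth (fps_inv \<psi>) 0 = 0"
      using fps_inv[OF \<psi>0 \<psi>1] fps_inv_right[OF \<psi>0 \<psi>1] by (auto simp: fps_inv_def)
    have const: "range fps_const \<subseteq> regular_functions \<psi>"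
      by (auto simp: regular_functions_def fps_of_int_const)
    show ?thesis
    proof
      assume "regular_functions (homothety l oo g) \<noteq> range fps_const"
      then obtain \<alpha> where \<alpha>: "\<alpha> \<in> regular_functions \<psi>" "\<alpha> \<notin> range fps_const"
        using const unfolding \<psi>_def by blast
      define f where "f = fps_of_int \<alpha> oo fps_inv \<psi>"
      have f\<psi>: "f oo \<psi> = fps_of_int \<alpha>"
        using \<psi>i \<psi>0 by (simp add: f_def fps_compose_assoc[symmetric])
      have "f \<notin> range fps_const"
      proof
        assume "f \<in> range fps_const"
        then obtain c where "f = fps_const c" by blast
        then have "fps_of_int \<alpha> = fps_const c" using f\<psi> by simp
        then have "fps_nth (fps_of_int \<alpha>) (Suc j) = 0" for j by simp
        then have "fps_nth \<alpha> (Suc j) = 0" for j by (simp add: fps_of_int_def)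
        with \<alpha>(2) show False by (simp add: fps_nonconst_iff)
      qed
      then obtain j where j: "fps_nth f (Suc j) \<noteq> 0" by (auto simp: fps_nonconst_iff)
      have "fps_conv_radius f > 1" using \<alpha>(1) by (simp add: f_def regular_functions_def)
      then obtain N where N: "\<And>n k. n \<ge> N \<Longrightarrow> \<bar>fps_nth f k\<bar> \<le> geometric_bound n k"
        by (rule conv_radius_gt_1_imp_bound) blast
      obtain M where M: "1 / \<bar>fps_nth f (Suc j)\<bar> \<le> real M" using real_arch_simple by blast
      have "1 / real (max N M + 1) \<le> \<bar>fps_nth f (Suc j)\<bar>"
      proof -
        have "1 / \<bar>fps_nth f (Suc j)\<bar> \<le> real (max N M + 1)" using M by linarith
        then show ?thesis using j by (simp add: field_simps)
      qed
      moreover have "f oo \<psi> \<in> int_series" by (simp add: f\<psi> int_series_eq)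
      ultimately have "g \<in> bad_series l (max N M) j"
        using N[of "max N M"] g by (auto simp: bad_series_def \<psi>_def)
      then show "\<exists>n j. g \<in> bad_series l n j" by blast
    next
      assume "\<exists>n j. g \<in> bad_series l n j"
      then obtain n j f where f: "\<And>k. \<bar>fps_nth f k\<bar> \<le> geometric_bound n k"
        "\<bar>fps_nth f (Suc j)\<bar> \<ge> 1 / real (n + 1)" "f oo \<psi> \<in> int_series"
        by (auto simp: bad_series_def \<psi>_def)
      then obtain \<alpha> where \<alpha>: "f oo \<psi> = fps_of_int \<alpha>" by (auto simp: int_series_eq)
      then have f\<alpha>: "fps_of_int \<alpha> oo fps_inv \<psi> = f"
        using \<psi>i \<psi>0 by (simp add: \<alpha>[symmetric] fps_compose_assoc[symmetric])
      have "\<alpha> \<in> regular_functions \<psi>"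
        using bound_imp_conv_radius_gt_1[OF f(1)] by (simp add: regular_functions_def f\<alpha>)
      moreover have "\<alpha> \<notin> range fps_const"
      proof
        assume "\<alpha> \<in> range fps_const"
        then have "f \<in> range fps_const" by (auto simp: f\<alpha>[symmetric] fps_of_int_const)
        then have "fps_nth f (Suc j) = 0" by auto
        then show False using f(2) by simp
      qed
      ultimately show "regular_functions (homothety l oo g) \<noteq> range fps_const"
        unfolding \<psi>_def by blast
    qed
  qed
  then have "regular_functions (homothety l oo g) = range fps_const \<longleftrightarrow> g \<notin> (\<Union>(n, j)\<in>UNIV. bad_series l n j)"
    if "g \<in> carrier D_real" for g
    unfolding UN_iff using that by blast
  then show ?thesis unfolding T_set_def by blast
qed

text \<open>
  The pairs of \<open>f\<close> and \<open>g\<close> form a closed set, as the coefficients of a composition are polynomials in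
  those of its factors; projecting along the compact set of the \<open>f\<close> keeps it closed.
\<close>

lemma closed_bad_series: "closedin D_top (bad_series l n j)"
proof -
  let ?K = "{f :: nat \<Rightarrow> real. \<forall>k. \<bar>f k\<bar> \<le> geometric_bound n k}"
  let ?c = "\<lambda>z :: (nat \<Rightarrow> real) \<times> (nat \<Rightarrow> real). Abs_fps (fst z) oo (homothety l oo ser (snd z))"
  have c: "coeff_continuous ?c"
  proof (intro coeff_continuous_compose coeff_continuous_const)
    show "coeff_continuous (\<lambda>z :: (nat \<Rightarrow> real) \<times> (nat \<Rightarrow> real). Abs_fps (fst z))"
      using continuous_on_product_then_coordinatewise[OF continuous_on_fst[OF continuous_on_id]]
      by (auto simp: coeff_continuous_def)
    show "coeff_continuous (\<lambda>z :: (nat \<Rightarrow> real) \<times> (nat \<Rightarrow> real). ser (snd z))"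
      using coeff_continuous_ser
      by (auto simp: coeff_continuous_def intro: continuous_on_compose2[OF _ continuous_on_snd[OF continuous_on_id]])
  qed
  have "continuous_on UNIV (\<lambda>z :: (nat \<Rightarrow> real) \<times> (nat \<Rightarrow> real). fst z (Suc j))"
    by (rule continuous_on_product_then_coordinatewise) (intro continuous_intros)
  then have "closed ((\<lambda>z :: (nat \<Rightarrow> real) \<times> (nat \<Rightarrow> real). \<bar>fst z (Suc j)\<bar>) -` {1 / real (n + 1)..})"
    by (intro closed_vimage continuous_intros) auto
  moreover have "closed (\<Inter>m. (\<lambda>z. fps_nth (?c z) m) -` \<int>)"
    using c unfolding coeff_continuous_def by (intro closed_INT ballI closed_vimage closed_Ints) auto
  ultimately have "closed ((\<lambda>z :: (nat \<Rightarrow> real) \<times> (nat \<Rightarrow> real). \<bar>fst z (Suc j)\<bar>) -` {1 / real (n + 1)..}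
      \<inter> (\<Inter>m. (\<lambda>z. fps_nth (?c z) m) -` \<int>))" (is "closed ?Z")
    by (rule closed_Int)
  then have "closed {x. \<exists>f\<in>?K. (f, x) \<in> ?Z}"
    by (intro closed_compact_projection_left compact_box)
  also have "{x. \<exists>f\<in>?K. (f, x) \<in> ?Z} = {x. ser x \<in> bad_series l n j}"
  proof (intro equalityI subsetI)
    fix x assume "x \<in> {x. ser x \<in> bad_series l n j}"
    then obtain f where f: "\<forall>k. \<bar>fps_nth f k\<bar> \<le> geometric_bound n k"
      "\<bar>fps_nth f (Suc j)\<bar> \<ge> 1 / real (n + 1)" "f oo (homothety l oo ser x) \<in> int_series"
      by (auto simp: bad_series_def)
    then show "x \<in> {x. \<exists>f\<in>?K. (f, x) \<in> ?Z}"
      by (auto intro!: exI[of _ "fps_nth f"] simp: fps_nth_inverse int_series_def)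
  next
    fix x assume "x \<in> {x. \<exists>f\<in>?K. (f, x) \<in> ?Z}"
    then obtain f where "f \<in> ?K" "(f, x) \<in> ?Z" by blast
    then show "x \<in> {x. ser x \<in> bad_series l n j}"
      by (auto simp: bad_series_def int_series_def intro!: exI[of _ "Abs_fps f"])
  qed
  finally show ?thesis by (auto simp: closedin_D_top bad_series_def)
qed

text \<open>
  The same \<open>f\<close> serves for both series, as the integral series is merely composed with \<open>h\<close>.
\<close>

lemma bad_series_right_translate:
  assumes "g \<in> bad_series l n j" "h \<in> D_int"
  shows "g oo h \<in> bad_series l n j"
proof -
  obtain f where f: "\<forall>k. \<bar>fps_nth f k\<bar> \<le> geometric_bound n k"
    "\<bar>fps_nth f (Suc j)\<bar> \<ge> 1 / real (n + 1)" "f oo (homothety l oo g) \<in> int_series"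
    and g: "g \<in> carrier D_real" using assms(1) by (auto simp: bad_series_def)
  have h: "h \<in> carrier D_real" "h \<in> int_series" using assms(2) by (auto simp: D_int_eq)
  have "f oo (homothety l oo (g oo h)) = (f oo (homothety l oo g)) oo h"
    using g h(1) by (simp add: fps_compose_assoc mem_D_real homothety_0)
  then have "f oo (homothety l oo (g oo h)) \<in> int_series"
    using int_series_compose[OF f(3) h(2)] by simp
  then show ?thesis using f g h by (auto simp: bad_series_def D_real_comp)
qed

lemma D_proj_bad_series_iff:
  assumes "g \<in> carrier D_real"
  shows "D_proj g \<in> D_proj ` bad_series l n j \<longleftrightarrow> g \<in> bad_series l n j"
proof
  assume "D_proj g \<in> D_proj ` bad_series l n j"
  then obtain b where b: "b \<in> bad_series l n j" "D_proj b = D_proj g" by auto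
  then obtain h where "h \<in> D_int" "g = b oo h"
    using assms D_proj_eq_iff[of b g] by (auto simp: bad_series_def)
  then show "g \<in> bad_series l n j" using bad_series_right_translate[OF b(1)] by simp
qed auto

lemma right_invariant_T_set:
  assumes "l \<noteq> 0"
  shows "right_invariant (T_set l)"
  unfolding right_invariant_def
proof (intro ballI)
  fix g h assume g: "g \<in> T_set l" and h: "h \<in> D_int"
  have c: "g \<in> carrier D_real" "h \<in> carrier D_real"
    using g h by (auto simp: T_set_def D_int_eq)
  then have "D_proj (g oo h) = D_proj g" "g oo h \<in> carrier D_real"
    using D_proj_eq_iff[of g "g oo h"] h by (auto simp: D_real_comp)
  then have "g oo h \<in> bad_series l n j \<longleftrightarrow> g \<in> bad_series l n j" for n j
    using D_proj_bad_series_iff[of "g oo h"] D_proj_bad_series_iff[of g] c by metis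
  then show "g \<otimes>\<^bsub>D_real\<^esub> h \<in> T_set l"
    using g \<open>g oo h \<in> carrier D_real\<close> by (simp add: T_set_eq[OF assms])
qed

lemma gdelta_T_set:
  assumes "l \<noteq> 0"
  shows "gdelta_in D_top (T_set l)"
proof -
  have "fsigma_in D_top (\<Union>(n, j)\<in>UNIV. bad_series l n j)"
    by (intro fsigma_in_Union) (auto intro!: closed_imp_fsigma_in closed_bad_series)
  moreover have "topspace D_top - T_set l = (\<Union>(n, j)\<in>UNIV. bad_series l n j)"
    by (auto simp: T_set_eq[OF assms] topspace_D_top bad_series_def)
  ultimately show ?thesis by (auto simp: gdelta_in_fsigma_in topspace_D_top T_set_def)
qed

lemma borel_T_set:
  assumes "l \<noteq> 0"
  shows "T_set l \<in> sets (borel_sigma D_top)"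
proof -
  have "T_set l = space (borel_sigma D_top) - (\<Union>(n, j)\<in>UNIV. bad_series l n j)"
    by (simp add: T_set_eq[OF assms] space_borel_sigma topspace_D_top)
  also have "\<dots> \<in> sets (borel_sigma D_top)"
    by (intro sets.compl_sets sets.countable_UN'') (auto intro: closed_in_borel_sigma closed_bad_series)
  finally show ?thesis .
qed

lemma borel_D_proj_T_set:
  assumes "l \<noteq> 0"
  shows "D_proj ` T_set l \<in> sets (borel_sigma D_quot_top)"
    and "pt -` (D_proj ` T_set l) = {x. ser x \<in> T_set l}"
proof -
  have cl: "closedin D_quot_top (D_proj ` bad_series l n j)" for n j
  proof -
    have "{x. pt x \<in> D_proj ` bad_series l n j} = {x. ser x \<in> bad_series l n j}"
      by (simp add: pt_def D_proj_bad_series_iff)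
    then show ?thesis
      using closed_bad_series[of l n j] by (auto simp: closedin_D_quot closedin_D_top range_pt bad_series_def)
  qed
  have eq: "D_proj ` T_set l = space (borel_sigma D_quot_top) - (\<Union>(n, j)\<in>UNIV. D_proj ` bad_series l n j)"
  proof -
    have "D_proj g \<in> D_proj ` T_set l \<longleftrightarrow> (\<forall>n j. D_proj g \<notin> D_proj ` bad_series l n j)"
      if g: "g \<in> carrier D_real" for g
    proof
      assume "D_proj g \<in> D_proj ` T_set l"
      then obtain g' where "g' \<in> T_set l" "D_proj g = D_proj g'" by blast
      then show "\<forall>n j. D_proj g \<notin> D_proj ` bad_series l n j"
        by (simp add: T_set_eq[OF assms] D_proj_bad_series_iff)
    qed (use g in \<open>auto simp: T_set_eq[OF assms] D_proj_bad_series_iff\<close>)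
    note in_image = this
    show ?thesis
      unfolding space_borel_sigma topspace_D_quot range_pt
    proof (rule Set.set_eqI)
      fix C
      show "C \<in> D_proj ` T_set l \<longleftrightarrow>
          C \<in> D_proj ` carrier D_real - (\<Union>(n, j)\<in>UNIV. D_proj ` bad_series l n j)"
      proof (cases "C \<in> D_proj ` carrier D_real")
        case True
        then obtain g where "g \<in> carrier D_real" "C = D_proj g" by blast
        then show ?thesis using in_image[of g] True by simp
      next
        case False
        then show ?thesis by (auto simp: T_set_def)
      qed
    qed
  qed
  show "D_proj ` T_set l \<in> sets (borel_sigma D_quot_top)"
    unfolding eq by (intro sets.compl_sets sets.countable_UN'') (auto intro: closed_in_borel_sigma cl)
  have "pt x \<in> D_proj ` T_set l \<longleftrightarrow> ser x \<in> T_set l" for x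
    by (subst eq, subst T_set_eq[OF assms])
      (simp add: space_borel_sigma topspace_D_quot range_pt pt_def D_proj_bad_series_iff)
  then show "pt -` (D_proj ` T_set l) = {x. ser x \<in> T_set l}" by auto
qed

section \<open>The first moment estimate\<close>

text \<open>Density needs series with prescribed first coefficients; the remaining ones stay random.\<close>

definition prescribed :: "nat \<Rightarrow> (nat \<Rightarrow> real) \<Rightarrow> (nat \<Rightarrow> real) \<Rightarrow> real fps" where
  "prescribed n c x = ser (\<lambda>k. if k < n then c k else x k)"

lemma prescribed_in_D_real [simp]: "prescribed n c x \<in> carrier D_real"
  by (simp add: prescribed_def)

lemma prescribed_0 [simp]: "prescribed 0 c x = ser x"
  by (simp add: prescribed_def)

lemma agree_prescribed:
  assumes "n \<le> j"
  shows "agree (j + 2) (t - x j) (prescribed n c x) (prescribed n c (x(j := t)))"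
  using assms by (auto simp: agree_def prescribed_def ser_nth)

text \<open>
  The formal function \<open>\<alpha>\<close> written in the coordinate given by the random series, that is, the
  coordinate of the disk before the homothety. If \<open>\<alpha>\<close> is regular, its coefficients decay
  geometrically.
\<close>

definition expansion :: "nat \<Rightarrow> (nat \<Rightarrow> real) \<Rightarrow> int fps \<Rightarrow> (nat \<Rightarrow> real) \<Rightarrow> real fps" where
  "expansion n c \<alpha> x = fps_of_int \<alpha> oo fps_inv (prescribed n c x)"

lemma coeff_measurable_expansion: "coeff_measurable unif_seq (expansion n c \<alpha>)"
proof -
  have "coeff_measurable unif_seq (prescribed n c)"
    unfolding coeff_measurable_def
  proof
    fix m
    have "(\<lambda>x. fps_nth (ser x) k) \<in> borel_measurable unif_seq" for k
      using coeff_measurable_ser by (simp add: coeff_measurable_def)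
    note * = this
    consider "m < n + 2" | "m \<ge> n + 2" by linarith
    then show "(\<lambda>x. fps_nth (prescribed n c x) m) \<in> borel_measurable unif_seq"
    proof cases
      case 1
      then have "(\<lambda>x. fps_nth (prescribed n c x) m) = (\<lambda>x. fps_nth (ser c) m)"
        by (intro ext) (auto simp: prescribed_def ser_nth)
      then show ?thesis by simp
    next
      case 2
      then have "(\<lambda>x. fps_nth (prescribed n c x) m) = (\<lambda>x. fps_nth (ser x) m)"
        by (intro ext) (auto simp: prescribed_def ser_nth)
      then show ?thesis using * by simp
    qed
  qed
  then have "coeff_measurable unif_seq (\<lambda>x. fps_of_int \<alpha> oo fps_inv (prescribed n c x))"
    by (intro coeff_measurable_compose coeff_measurable_const coeff_measurable_inv prescribed_in_D_real)
  then show ?thesis by (simp add: expansion_def[abs_def])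
qed

text \<open>
  Up to sign the slope in \<open>t\<close> is the integer \<open>(m + 1) \<alpha>\<^sub>m\<^sub>+\<^sub>1\<close>. When it is nonzero, a uniform coordinate therefore spreads
  the coefficient of index \<open>j + m + 2\<close> over the circle, while the earlier coefficients stay fixed.
\<close>

lemma agree_expansion:
  assumes "n \<le> j" and \<alpha>: "\<And>i. 0 < i \<Longrightarrow> i < Suc m \<Longrightarrow> fps_nth \<alpha> i = 0"
  shows "agree (j + 2 + m) (of_int (fps_nth \<alpha> (Suc m)) * real (Suc m) * (x j - t))
    (expansion n c \<alpha> x) (expansion n c \<alpha> (x(j := t)))"
proof -
  have "agree (j + 2) (- (t - x j)) (fps_inv (prescribed n c x)) (fps_inv (prescribed n c (x(j := t))))"
    using assms(1) by (intro agree_inv agree_prescribed) auto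
  then have "agree (j + 2 + m) (fps_nth (fps_of_int \<alpha>) (Suc m) * real (Suc m) * (- (t - x j)))
    (expansion n c \<alpha> x) (expansion n c \<alpha> (x(j := t)))"
    unfolding expansion_def using \<alpha>
    by (intro agree_compose_right D_real_inv) (auto simp: fps_of_int_def)
  then show ?thesis by (simp add: fps_of_int_def)
qed

text \<open>
  The constant \<open>10\<close> is \<open>2 \<cdot> 5\<close>: each of the intervals has length at most \<open>2\<epsilon>/|s|\<close>, and at most
  \<open>2|s| + 2\<epsilon> + 1 \<le> 5|s|\<close> of them meet \<open>[0, 1)\<close>.
\<close>

lemma sum_unif_near_integers:
  fixes s u \<epsilon> :: real and A :: "int set"
  assumes "\<bar>s\<bar> \<ge> 1" "0 < \<epsilon>" "\<epsilon> \<le> 1" "finite A"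
  shows "(\<Sum>a\<in>A. emeasure unif {t. \<bar>u - s * t + of_int a\<bar> \<le> \<epsilon>}) \<le> ennreal (10 * \<epsilon>)"
proof -
  let ?I = "\<lambda>a. {t. \<bar>u - s * t + of_int a\<bar> \<le> \<epsilon>}"
  let ?lo = "\<lceil>- u - \<bar>s\<bar> - \<epsilon>\<rceil>" and ?hi = "\<lfloor>- u + \<bar>s\<bar> + \<epsilon>\<rfloor>"
  have s0: "s \<noteq> 0" using assms(1) by auto
  have I: "?I a \<in> sets borel" for a by measurable
  have outside: "emeasure unif (?I a) = 0" if "a \<notin> {?lo..?hi}" for a
  proof -
    have "?I a \<inter> {0..<1} = {}"
    proof (rule ccontr)
      assume "?I a \<inter> {0..<1} \<noteq> {}"
      then obtain t where t: "0 \<le> t" "t < 1" "\<bar>u - s * t + of_int a\<bar> \<le> \<epsilon>" by auto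
      have "\<bar>s * t\<bar> \<le> \<bar>s\<bar>" using t(1,2) by (simp add: abs_mult mult_left_le)
      then have "- u - \<bar>s\<bar> - \<epsilon> \<le> of_int a" "of_int a \<le> - u + \<bar>s\<bar> + \<epsilon>" using t(3) by linarith+
      then have "a \<in> {?lo..?hi}" by (simp add: ceiling_le_iff le_floor_iff)
      with that show False by simp
    qed
    then show ?thesis using I by (simp add: emeasure_unif)
  qed
  have each: "emeasure unif (?I a) \<le> ennreal (2 * \<epsilon> / \<bar>s\<bar>)" for a
  proof -
    let ?m = "(u + of_int a) / s"
    have "?I a \<subseteq> {?m - \<epsilon> / \<bar>s\<bar>..?m + \<epsilon> / \<bar>s\<bar>}"
    proof
      fix t assume "t \<in> ?I a"
      moreover have "u - s * t + of_int a = s * (?m - t)" using s0 by (simp add: field_simps)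
      ultimately have "\<bar>s\<bar> * \<bar>?m - t\<bar> \<le> \<epsilon>" by (simp add: abs_mult)
      then have "\<bar>?m - t\<bar> \<le> \<epsilon> / \<bar>s\<bar>" using s0 by (simp add: field_simps)
      then show "t \<in> {?m - \<epsilon> / \<bar>s\<bar>..?m + \<epsilon> / \<bar>s\<bar>}" by (auto simp: abs_le_iff)
    qed
    then have "emeasure unif (?I a) \<le> emeasure lborel {?m - \<epsilon> / \<bar>s\<bar>..?m + \<epsilon> / \<bar>s\<bar>}"
      using I by (subst emeasure_unif) (auto intro!: emeasure_mono)
    also have "\<dots> = ennreal (2 * \<epsilon> / \<bar>s\<bar>)"
      using assms(2) by (subst emeasure_lborel_Icc) (auto simp: field_simps)
    finally show ?thesis .
  qed
  have card: "real (card (A \<inter> {?lo..?hi})) \<le> 5 * \<bar>s\<bar>"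
  proof -
    have "card (A \<inter> {?lo..?hi}) \<le> card {?lo..?hi}" by (intro card_mono) auto
    also have "\<dots> = nat (?hi - ?lo + 1)" by simp
    finally have "real (card (A \<inter> {?lo..?hi})) \<le> max 0 (of_int ?hi - of_int ?lo + 1)" by linarith
    moreover have "of_int ?hi \<le> - u + \<bar>s\<bar> + \<epsilon>" "- u - \<bar>s\<bar> - \<epsilon> \<le> of_int ?lo" by linarith+
    ultimately show ?thesis using assms(1,3) by linarith
  qed
  have "(\<Sum>a\<in>A. emeasure unif (?I a)) = (\<Sum>a\<in>A \<inter> {?lo..?hi}. emeasure unif (?I a))"
    using assms(4) outside by (intro sum.mono_neutral_right) auto
  also have "\<dots> \<le> (\<Sum>a\<in>A \<inter> {?lo..?hi}. ennreal (2 * \<epsilon> / \<bar>s\<bar>))"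
    using each by (intro sum_mono) auto
  also have "\<dots> = ennreal (real (card (A \<inter> {?lo..?hi})) * (2 * \<epsilon> / \<bar>s\<bar>))"
    using assms(2) by (subst ennreal_mult) (auto simp: ennreal_of_nat_eq_real_of_nat)
  also have "\<dots> \<le> ennreal (5 * \<bar>s\<bar> * (2 * \<epsilon> / \<bar>s\<bar>))"
    using card assms(2) by (intro ennreal_leI mult_right_mono) auto
  also have "5 * \<bar>s\<bar> * (2 * \<epsilon> / \<bar>s\<bar>) = 10 * \<epsilon>" using s0 by simp
  finally show ?thesis .
qed

definition trunc_series :: "int list \<Rightarrow> int fps" where
  "trunc_series ys = Abs_fps (\<lambda>k. if k < length ys then ys ! k else 0)"

lemma agree_trunc_series:
  "agree (length ys) (of_int a) (fps_of_int (trunc_series ys)) (fps_of_int (trunc_series (ys @ [a])))"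
  by (auto simp: agree_def fps_of_int_def trunc_series_def nth_append)

text \<open>
  The event that the integers \<open>ys\<close> can be the first coefficients of an integral series whose
  expansion decays like \<open>\<rho>\<^sup>k\<close>. The coefficients of index below \<open>K\<close> are left free, because
  there are only countably many prefixes of length \<open>K\<close> and each of them is treated separately.
\<close>

definition admissible :: "real \<Rightarrow> nat \<Rightarrow> (nat \<Rightarrow> real) \<Rightarrow> nat \<Rightarrow> int list \<Rightarrow> (nat \<Rightarrow> real) set" where
  "admissible \<rho> n c K ys = {x. \<forall>k. K \<le> k \<longrightarrow> k < length ys \<longrightarrow>
     \<bar>fps_nth (expansion n c (trunc_series ys) x) k\<bar> \<le> \<rho> ^ k}"

lemma sets_admissible: "admissible \<rho> n c K ys \<in> sets unif_seq"
proof -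
  have [measurable]: "(\<lambda>x. fps_nth (expansion n c (trunc_series ys) x) k) \<in> borel_measurable unif_seq" for k
    using coeff_measurable_expansion by (simp add: coeff_measurable_def)
  have "{x \<in> space unif_seq. \<forall>k\<in>{K..<length ys}. \<bar>fps_nth (expansion n c (trunc_series ys) x) k\<bar> \<le> \<rho> ^ k}
      \<in> sets unif_seq" by measurable
  moreover have "admissible \<rho> n c K ys = {x \<in> space unif_seq. \<forall>k\<in>{K..<length ys}. \<bar>fps_nth (expansion n c (trunc_series ys) x) k\<bar> \<le> \<rho> ^ k}"
    by (auto simp: admissible_def)
  ultimately show ?thesis by simp
qed

lemma expansion_snoc:
  "agree (length ys) (of_int a) (expansion n c (trunc_series ys) x) (expansion n c (trunc_series (ys @ [a])) x)"
  unfolding expansion_def by (intro agree_compose_left agree_trunc_series D_real_inv prescribed_in_D_real)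

lemma admissible_snoc:
  assumes "K \<le> length ys"
  shows "admissible \<rho> n c K (ys @ [a]) = {x \<in> admissible \<rho> n c K ys.
    \<bar>fps_nth (expansion n c (trunc_series ys) x) (length ys) + of_int a\<bar> \<le> \<rho> ^ length ys}"
proof -
  note sn = expansion_snoc[of ys a n c]
  have "fps_nth (expansion n c (trunc_series (ys @ [a])) x) k = fps_nth (expansion n c (trunc_series ys) x) k"
    if "k < length ys" for k x
    by (rule agree_below[OF sn that])
  moreover have "fps_nth (expansion n c (trunc_series (ys @ [a])) x) (length ys)
      = fps_nth (expansion n c (trunc_series ys) x) (length ys) + of_int a" for x
    by (rule agree_at[OF sn])
  ultimately show ?thesis using assms by (auto simp: admissible_def less_Suc_eq)
qed

text \<open>
  Given the earlier coefficients, the next coefficient of the integral series has to be close to a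
  number that a still unused random coordinate spreads over the circle. So the expected number of admissible
  integers is small, whatever the earlier coefficients are.
\<close>

lemma sum_admissible_snoc:
  assumes \<rho>: "0 < \<rho>" "\<rho> < 1" and K: "K \<le> length ys" "n + m + 2 \<le> length ys"
    and lead: "\<And>i. 0 < i \<Longrightarrow> i < Suc m \<Longrightarrow> ys ! i = 0" "ys ! Suc m \<noteq> 0"
    and A: "finite A"
  shows "(\<Sum>a\<in>A. emeasure unif_seq (admissible \<rho> n c K (ys @ [a])))
    \<le> emeasure unif_seq (admissible \<rho> n c K ys) * ennreal (10 * \<rho> ^ length ys)"
proof -
  define L where "L = length ys"
  \<comment> \<open>The coordinate that is first felt at the index \<open>L\<close>.\<close>
  define j where "j = L - m - 2"
  have j: "n \<le> j" "j + 2 + m = L" using K by (auto simp: j_def L_def)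
  let ?\<alpha> = "trunc_series ys"
  let ?E = "admissible \<rho> n c K ys"
  define s where "s = of_int (fps_nth ?\<alpha> (Suc m)) * real (Suc m)"
  define b where "b x = fps_nth (expansion n c ?\<alpha> x) L" for x
  have s: "\<bar>s\<bar> \<ge> 1"
  proof -
    have "\<bar>fps_nth ?\<alpha> (Suc m)\<bar> \<ge> 1" using lead(2) j by (simp add: trunc_series_def L_def)
    then have "1 \<le> \<bar>real_of_int (fps_nth ?\<alpha> (Suc m))\<bar>" by linarith
    then have "1 * 1 \<le> \<bar>real_of_int (fps_nth ?\<alpha> (Suc m))\<bar> * real (Suc m)"
      by (intro mult_mono) auto
    then show ?thesis by (simp add: s_def abs_mult)
  qed
  have lead': "fps_nth ?\<alpha> i = 0" if "0 < i" "i < Suc m" for i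
    using lead(1)[OF that] by (simp add: trunc_series_def)
  have ag: "agree L (s * (x j - t)) (expansion n c ?\<alpha> x) (expansion n c ?\<alpha> (x(j := t)))" for x t
    unfolding j(2)[symmetric] s_def by (rule agree_expansion[OF j(1)]) (rule lead')
  have E: "x(j := t) \<in> ?E \<longleftrightarrow> x \<in> ?E" for x t
    using agree_below[OF ag] by (simp add: admissible_def L_def)
  have b: "b (x(j := t)) = (b x + s * x j) - s * t" for x t
    using agree_at[OF ag[of x t]] by (simp add: b_def algebra_simps)
  have snoc: "admissible \<rho> n c K (ys @ [a]) = {x \<in> ?E. \<bar>b x + of_int a\<bar> \<le> \<rho> ^ L}" for a
    unfolding admissible_snoc[OF K(1)] by (simp add: b_def L_def)
  let ?I = "\<lambda>x a. {t. \<bar>(b x + s * x j) - s * t + of_int a\<bar> \<le> \<rho> ^ L}"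
  have I: "?I x a \<in> sets unif" for x a
    by (simp, measurable)
  have inner: "(\<integral>\<^sup>+t. indicator (admissible \<rho> n c K (ys @ [a])) (x(j := t)) \<partial>unif) = indicator ?E x * emeasure unif (?I x a)" for x a
  proof -
    have "(\<integral>\<^sup>+t. indicator (admissible \<rho> n c K (ys @ [a])) (x(j := t)) \<partial>unif)
        = (\<integral>\<^sup>+t. indicator ?E x * indicator (?I x a) t \<partial>unif)"
      by (intro nn_integral_cong) (simp add: snoc E b indicator_def)
    also have "\<dots> = indicator ?E x * emeasure unif (?I x a)"
      using I by (simp add: nn_integral_cmult)
    finally show ?thesis .
  qed
  have P: "emeasure unif_seq (admissible \<rho> n c K (ys @ [a])) = (\<integral>\<^sup>+x. indicator ?E x * emeasure unif (?I x a) \<partial>unif_seq)" for a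
  proof -
    have "emeasure unif_seq (admissible \<rho> n c K (ys @ [a])) = (\<integral>\<^sup>+x. indicator (admissible \<rho> n c K (ys @ [a])) x \<partial>unif_seq)"
      using sets_admissible by simp
    also have "\<dots> = (\<integral>\<^sup>+x. \<integral>\<^sup>+t. indicator (admissible \<rho> n c K (ys @ [a])) (x(j := t)) \<partial>unif \<partial>unif_seq)"
      using sets_admissible by (intro nn_integral_resample) auto
    finally show ?thesis by (simp only: inner)
  qed
  have meas: "(\<lambda>x. indicator ?E x * emeasure unif (?I x a)) \<in> borel_measurable unif_seq" for a
  proof -
    have [measurable]: "(\<lambda>(x, t). indicator (admissible \<rho> n c K (ys @ [a])) (x(j := t)) :: ennreal) \<in> borel_measurable (unif_seq \<Otimes>\<^sub>M unif)"
      using measurable_compose[OF measurable_resample[of j] borel_measurable_indicator[OF sets_admissible[of \<rho> n c K "ys @ [a]"]]]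
      by (simp add: case_prod_unfold)
    have "(\<lambda>x. \<integral>\<^sup>+t. indicator (admissible \<rho> n c K (ys @ [a])) (x(j := t)) \<partial>unif) \<in> borel_measurable unif_seq"
      by measurable
    then show ?thesis by (simp only: inner)
  qed
  have "(\<Sum>a\<in>A. emeasure unif_seq (admissible \<rho> n c K (ys @ [a])))
      = (\<integral>\<^sup>+x. (\<Sum>a\<in>A. indicator ?E x * emeasure unif (?I x a)) \<partial>unif_seq)"
    using meas by (simp add: P nn_integral_sum)
  also have "\<dots> \<le> (\<integral>\<^sup>+x. indicator ?E x * ennreal (10 * \<rho> ^ L) \<partial>unif_seq)"
  proof (intro nn_integral_mono)
    fix x
    have "(\<Sum>a\<in>A. emeasure unif (?I x a)) \<le> ennreal (10 * \<rho> ^ L)"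
      using \<rho> by (intro sum_unif_near_integers s A) (auto simp: power_le_one)
    then show "(\<Sum>a\<in>A. indicator ?E x * emeasure unif (?I x a)) \<le> indicator ?E x * ennreal (10 * \<rho> ^ L)"
      by (simp add: sum_distrib_left[symmetric] mult_left_mono)
  qed
  also have "\<dots> = emeasure unif_seq ?E * ennreal (10 * \<rho> ^ L)"
    using sets_admissible by (simp add: nn_integral_multc)
  finally show ?thesis by (simp add: L_def)
qed

text \<open>
  The left side is a first moment, the expected number of admissible prolongations in \<open>Z\<close>. Each new
  coefficient multiplies it by at most \<open>10 \<rho>\<^sup>k\<close>.
\<close>

lemma sum_admissible_append:
  assumes \<rho>: "0 < \<rho>" "\<rho> < 1" and K: "n + m + 2 \<le> length xs"
    and lead: "\<And>i. 0 < i \<Longrightarrow> i < Suc m \<Longrightarrow> xs ! i = 0" "xs ! Suc m \<noteq> 0"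
    and Z: "finite Z" "Z \<subseteq> {zs. length zs = L}"
  shows "(\<Sum>zs\<in>Z. emeasure unif_seq (admissible \<rho> n c (length xs) (xs @ zs)))
    \<le> ennreal (\<Prod>i<L. 10 * \<rho> ^ (length xs + i))"
  using Z
proof (induction L arbitrary: Z)
  case 0
  then have "Z \<subseteq> {[]}" by auto
  then have "Z = {} \<or> Z = {[]}" by auto
  then show ?case using unif_seq.emeasure_le_1 by auto
next
  case (Suc L)
  let ?p = "\<lambda>zs. emeasure unif_seq (admissible \<rho> n c (length xs) (xs @ zs))"
  let ?B = "butlast ` Z" and ?A = "last ` Z"
  have B: "finite ?B" "?B \<subseteq> {zs. length zs = L}" and A: "finite ?A" using Suc.prems by auto
  have "Z \<subseteq> (\<lambda>(zs, a). zs @ [a]) ` (?B \<times> ?A)"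
  proof
    fix zs assume zs: "zs \<in> Z"
    then have "zs \<noteq> []" using Suc.prems(2) by auto
    then have "zs = (\<lambda>(zs, a). zs @ [a]) (butlast zs, last zs)" by simp
    then show "zs \<in> (\<lambda>(zs, a). zs @ [a]) ` (?B \<times> ?A)" using zs by (intro image_eqI) auto
  qed
  then have "sum ?p Z \<le> sum ?p ((\<lambda>(zs, a). zs @ [a]) ` (?B \<times> ?A))"
    using A B by (intro sum_mono2) auto
  also have "\<dots> = (\<Sum>zs\<in>?B. \<Sum>a\<in>?A. ?p (zs @ [a]))"
    by (subst sum.reindex) (auto simp: inj_on_def sum.cartesian_product split_beta)
  also have "\<dots> \<le> (\<Sum>zs\<in>?B. ?p zs * ennreal (10 * \<rho> ^ (length xs + L)))"
  proof (intro sum_mono)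
    fix zs assume "zs \<in> ?B"
    then have "length zs = L" using B(2) by auto
    then show "(\<Sum>a\<in>?A. ?p (zs @ [a])) \<le> ?p zs * ennreal (10 * \<rho> ^ (length xs + L))"
      using sum_admissible_snoc[of \<rho> "length xs" "xs @ zs" n m ?A c] \<rho> K lead A
      by (simp add: nth_append)
  qed
  also have "\<dots> = sum ?p ?B * ennreal (10 * \<rho> ^ (length xs + L))"
    by (simp add: sum_distrib_right)
  also have "\<dots> \<le> ennreal (\<Prod>i<L. 10 * \<rho> ^ (length xs + i)) * ennreal (10 * \<rho> ^ (length xs + L))"
    using Suc.IH[OF B] by (rule mult_right_mono) simp
  also have "\<dots> = ennreal (\<Prod>i<Suc L. 10 * \<rho> ^ (length xs + i))"
    using \<rho> by (simp add: ennreal_mult[symmetric] prod_nonneg)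
  finally show ?case .
qed

lemma prod_geometric_tendsto_0:
  fixes \<rho> :: real
  assumes "0 < \<rho>" "\<rho> < 1"
  shows "(\<lambda>L. \<Prod>i<L. C * \<rho> ^ (K + i)) \<longlonglongrightarrow> 0"
proof -
  have "(\<lambda>i. C * \<rho> ^ (K + i)) \<longlonglongrightarrow> 0"
    using assms by (auto simp: power_add intro!: tendsto_mult_right_zero LIMSEQ_power_zero)
  then have "eventually (\<lambda>i. \<bar>C * \<rho> ^ (K + i)\<bar> < 1 / 2) sequentially"
    using order_tendstoD(2)[OF tendsto_rabs_zero, of _ _ "1/2"] by fastforce
  then obtain N where N: "\<And>i. i \<ge> N \<Longrightarrow> \<bar>C * \<rho> ^ (K + i)\<bar> < 1 / 2"
    by (auto simp: eventually_sequentially)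
  have "summable (\<lambda>L. \<Prod>i<L. C * \<rho> ^ (K + i))"
  proof (rule summable_ratio_test[of "1/2" N])
    fix L assume "N \<le> L"
    then have "\<bar>C * \<rho> ^ (K + L)\<bar> \<le> 1 / 2" using N[of L] by simp
    then have "norm (C * \<rho> ^ (K + L)) * norm (\<Prod>i<L. C * \<rho> ^ (K + i)) \<le> 1 / 2 * norm (\<Prod>i<L. C * \<rho> ^ (K + i))"
      by (intro mult_right_mono) auto
    then show "norm (\<Prod>i<Suc L. C * \<rho> ^ (K + i)) \<le> 1 / 2 * norm (\<Prod>i<L. C * \<rho> ^ (K + i))"
      by (simp only: prod.lessThan_Suc norm_mult mult.commute)
  qed simp
  then show ?thesis by (rule summable_LIMSEQ_zero)
qed

text \<open>
  A prefix has countably many prolongations of each length, and by the first moment estimate the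
  probability that one of them is admissible tends to \<open>0\<close> with the length.
\<close>

lemma AE_no_extension:
  assumes \<rho>: "0 < \<rho>" "\<rho> < 1" and K: "n + m + 2 \<le> length xs"
    and lead: "\<And>i. 0 < i \<Longrightarrow> i < Suc m \<Longrightarrow> xs ! i = 0" "xs ! Suc m \<noteq> 0"
  shows "AE x in unif_seq. \<not> (\<exists>\<alpha>. (\<forall>k<length xs. fps_nth \<alpha> k = xs ! k) \<and>
    (\<forall>k\<ge>length xs. \<bar>fps_nth (expansion n c \<alpha> x) k\<bar> \<le> \<rho> ^ k))"
proof -
  let ?E = "\<lambda>zs. admissible \<rho> n c (length xs) (xs @ zs)"
  define W where "W L = (\<Union>zs\<in>{zs. length zs = L}. ?E zs)" for L
  have W: "W L \<in> sets unif_seq" for L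
    unfolding W_def using sets_admissible by (intro sets.countable_UN'') auto
  have Wle: "emeasure unif_seq (W L) \<le> ennreal (\<Prod>i<L. 10 * \<rho> ^ (length xs + i))" for L
  proof -
    \<comment> \<open>The first moment bound concerns finite sets of prolongations, so exhaust the union by such sets.\<close>
    define Z where "Z N = {zs :: int list. length zs = L \<and> to_nat zs < N}" for N
    have finZ: "finite (Z N)" for N
    proof -
      have "Z N \<subseteq> from_nat ` {..<N}" by (auto simp: Z_def intro!: image_eqI[where x = "to_nat _"])
      then show ?thesis by (rule finite_subset) simp
    qed
    have "W L = (\<Union>N. \<Union>zs\<in>Z N. ?E zs)" by (auto simp: W_def Z_def)
    also have "emeasure unif_seq \<dots> = (SUP N. emeasure unif_seq (\<Union>zs\<in>Z N. ?E zs))"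
    proof (rule SUP_emeasure_incseq[symmetric])
      show "range (\<lambda>N. \<Union>zs\<in>Z N. ?E zs) \<subseteq> sets unif_seq"
        using finZ sets_admissible by (auto intro!: sets.finite_UN)
      show "incseq (\<lambda>N. \<Union>zs\<in>Z N. ?E zs)"
        by (intro incseq_SucI UN_mono) (auto simp: Z_def)
    qed
    also have "\<dots> \<le> ennreal (\<Prod>i<L. 10 * \<rho> ^ (length xs + i))"
    proof (rule SUP_least)
      fix N
      have "emeasure unif_seq (\<Union>zs\<in>Z N. ?E zs) \<le> (\<Sum>zs\<in>Z N. emeasure unif_seq (?E zs))"
        using finZ sets_admissible by (intro emeasure_subadditive_finite) auto
      also have "\<dots> \<le> ennreal (\<Prod>i<L. 10 * \<rho> ^ (length xs + i))"
        by (rule sum_admissible_append[OF \<rho> K lead finZ]) (auto simp: Z_def)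
      finally show "emeasure unif_seq (\<Union>zs\<in>Z N. ?E zs) \<le> ennreal (\<Prod>i<L. 10 * \<rho> ^ (length xs + i))" .
    qed
    finally show ?thesis .
  qed
  have "emeasure unif_seq (\<Inter>L. W L) \<le> 0"
  proof (rule LIMSEQ_le_const)
    show "(\<lambda>L. ennreal (\<Prod>i<L. 10 * \<rho> ^ (length xs + i))) \<longlonglongrightarrow> 0"
      using tendsto_ennrealI[OF prod_geometric_tendsto_0[OF \<rho>, of 10 "length xs"]] by simp
    have "emeasure unif_seq (\<Inter>L. W L) \<le> emeasure unif_seq (W L)" for L
      using W by (intro emeasure_mono) auto
    then show "\<exists>N. \<forall>L\<ge>N. emeasure unif_seq (\<Inter>L. W L) \<le> ennreal (\<Prod>i<L. 10 * \<rho> ^ (length xs + i))"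
      using Wle order_trans by blast
  qed
  moreover have "(\<Inter>L. W L) \<in> sets unif_seq" using W by (intro sets.countable_INT) auto
  ultimately have null: "(\<Inter>L. W L) \<in> null_sets unif_seq" by (intro null_setsI) simp
  have "x \<in> (\<Inter>L. W L)" if \<alpha>: "\<forall>k<length xs. fps_nth \<alpha> k = xs ! k"
    "\<forall>k\<ge>length xs. \<bar>fps_nth (expansion n c \<alpha> x) k\<bar> \<le> \<rho> ^ k" for x \<alpha>
  proof
    fix L
    define zs where "zs = map (\<lambda>i. fps_nth \<alpha> (length xs + i)) [0..<L]"
    have eq: "fps_nth (trunc_series (xs @ zs)) k = fps_nth \<alpha> k" if "k < length xs + L" for k
      using that \<alpha>(1) by (auto simp: trunc_series_def zs_def nth_append)
    have "fps_nth (expansion n c (trunc_series (xs @ zs)) x) k = fps_nth (expansion n c \<alpha> x) k"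
      if "k < length xs + L" for k
      unfolding expansion_def using that by (intro compose_nth_cong) (simp add: fps_of_int_def eq)
    then have "x \<in> ?E zs" using \<alpha>(2) by (simp add: admissible_def zs_def)
    moreover have "length zs = L" by (simp add: zs_def)
    ultimately show "x \<in> W L" by (auto simp: W_def)
  qed
  then show ?thesis by (intro AE_I'[OF null]) auto
qed

text \<open>
  The radius of convergence exceeds \<open>1\<close> after rescaling by \<open>l\<close>, so the expansion of a nonconstant
  regular function is eventually below \<open>\<bar>l\<bar>\<^sup>k\<close>. The prefix is taken long enough for this decay
  to have started, for the first nonzero coefficient beyond the constant one to occur in it, and for
  the coordinates that matter to be random.
\<close>

theorem AE_prescribed_in_T_set:
  assumes l: "0 < \<bar>l\<bar>" "\<bar>l\<bar> < 1"
  shows "AE x in unif_seq. prescribed n c x \<in> T_set l"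
proof -
  have "AE x in unif_seq. \<forall>xs m. n + m + 2 \<le> length xs \<longrightarrow> (\<forall>i. 0 < i \<longrightarrow> i < Suc m \<longrightarrow> xs ! i = 0) \<longrightarrow>
      xs ! Suc m \<noteq> 0 \<longrightarrow> \<not> (\<exists>\<alpha>. (\<forall>k<length xs. fps_nth \<alpha> k = xs ! k) \<and>
      (\<forall>k\<ge>length xs. \<bar>fps_nth (expansion n c \<alpha> x) k\<bar> \<le> \<bar>l\<bar> ^ k))"
    unfolding AE_all_countable
    using AE_no_extension[OF l, of n] by (intro allI) (auto intro!: AE_impI)
  then show ?thesis
  proof (rule AE_mp[OF _ AE_I2], intro impI)
    fix x assume no: "\<forall>xs m. n + m + 2 \<le> length xs \<longrightarrow> (\<forall>i. 0 < i \<longrightarrow> i < Suc m \<longrightarrow> xs ! i = 0) \<longrightarrow>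
      xs ! Suc m \<noteq> 0 \<longrightarrow> \<not> (\<exists>\<alpha>. (\<forall>k<length xs. fps_nth \<alpha> k = xs ! k) \<and>
      (\<forall>k\<ge>length xs. \<bar>fps_nth (expansion n c \<alpha> x) k\<bar> \<le> \<bar>l\<bar> ^ k))"
    let ?g = "prescribed n c x"
    have l0: "l \<noteq> 0" using l(1) by simp
    show "?g \<in> T_set l"
    proof (rule ccontr)
      assume "?g \<notin> T_set l"
      then obtain p j where "?g \<in> bad_series l p j" by (auto simp: T_set_eq[OF l0])
      then obtain f where f: "\<And>k. \<bar>fps_nth f k\<bar> \<le> geometric_bound p k"
        "\<bar>fps_nth f (Suc j)\<bar> \<ge> 1 / real (p + 1)" "f oo (homothety l oo ?g) \<in> int_series"
        by (auto simp: bad_series_def)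
      then obtain \<alpha> where \<alpha>: "f oo (homothety l oo ?g) = fps_of_int \<alpha>" by (auto simp: int_series_eq)
      have g0: "fps_nth ?g 0 = 0" "fps_nth (fps_inv ?g) 0 = 0"
        using D_real_inv(1)[of ?g] prescribed_in_D_real[of n c x] by (simp_all add: mem_D_real)
      have "(f oo homothety l) oo ?g = fps_of_int \<alpha>"
        using \<alpha> g0 by (simp add: fps_compose_assoc homothety_0)
      then have exp: "expansion n c \<alpha> x = f oo homothety l"
        using D_real_inv[of ?g] D_real_comp_assoc[of ?g "fps_inv ?g" "f oo homothety l"]
        by (simp add: expansion_def)
      have "\<exists>i. fps_nth \<alpha> (Suc i) \<noteq> 0"
      proof (rule ccontr)
        assume "\<not> ?thesis"
        then have "\<alpha> \<in> range fps_const" using fps_nonconst_iff by blast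
        then have "expansion n c \<alpha> x \<in> range fps_const" by (auto simp: expansion_def fps_of_int_const)
        then have "fps_nth (f oo homothety l) (Suc j) = 0" using exp by auto
        then show False using f(2) l0 by (simp add: compose_homothety_nth)
      qed
      then obtain m where m: "fps_nth \<alpha> (Suc m) \<noteq> 0" "\<And>i. i < m \<Longrightarrow> fps_nth \<alpha> (Suc i) = 0"
        using exists_least_iff[of "\<lambda>i. fps_nth \<alpha> (Suc i) \<noteq> 0"] by blast
      have "eventually (\<lambda>k. geometric_bound p k < 1) sequentially"
        by (rule order_tendstoD(2)[OF geometric_bound_tendsto]) simp
      then obtain N where N: "\<And>k. k \<ge> N \<Longrightarrow> geometric_bound p k < 1"
        by (auto simp: eventually_sequentially)
      define K where "K = max N (n + m + 2)"
      define xs where "xs = map (fps_nth \<alpha>) [0..<K]"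
      have len: "length xs = K" by (simp add: xs_def)
      have "\<bar>fps_nth (expansion n c \<alpha> x) k\<bar> \<le> \<bar>l\<bar> ^ k" if "k \<ge> K" for k
      proof -
        have "\<bar>fps_nth f k\<bar> \<le> 1" using f(1)[of k] N[of k] that by (simp add: K_def)
        then have "\<bar>l\<bar> ^ k * \<bar>fps_nth f k\<bar> \<le> \<bar>l\<bar> ^ k * 1" by (intro mult_left_mono) auto
        then show ?thesis by (simp add: exp compose_homothety_nth abs_mult power_abs)
      qed
      moreover have "xs ! k = fps_nth \<alpha> k" if "k < K" for k using that by (simp add: xs_def)
      moreover have "\<forall>i. 0 < i \<longrightarrow> i < Suc m \<longrightarrow> xs ! i = 0"
      proof (intro allI impI)
        fix i assume "0 < i" "i < Suc m"
        then obtain i' where "i = Suc i'" "i' < m" by (cases i) auto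
        then show "xs ! i = 0" using m(2) by (simp add: xs_def K_def)
      qed
      moreover have "xs ! Suc m \<noteq> 0" using m(1) by (simp add: xs_def K_def)
      moreover have "n + m + 2 \<le> length xs" by (simp add: len K_def)
      ultimately show False using no[rule_format, of m xs] len by auto
    qed
  qed
qed

section \<open>Density and full measure\<close>

lemma open_contains_prescribed:
  fixes U :: "(nat \<Rightarrow> real) set"
  assumes "open U" "c \<in> U"
  obtains n where "\<And>x. (\<lambda>k. if k < n then c k else x k) \<in> U"
proof -
  have "openin (product_topology (\<lambda>_. euclidean) UNIV) U"
    using assms(1) by (simp add: euclidean_product_topology)
  from product_topology_open_contains_basis[OF this assms(2)]
  obtain X where X: "c \<in> Pi\<^sub>E UNIV X" "finite {i. X i \<noteq> (UNIV :: real set)}" "Pi\<^sub>E UNIV X \<subseteq> U"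
    by auto
  obtain n where n: "{i. X i \<noteq> UNIV} \<subseteq> {..<n}" using X(2) by (meson finite_nat_iff_bounded)
  have mem: "(\<lambda>k. if k < n then c k else x k) \<in> Pi\<^sub>E UNIV X" for x
    using X(1) n by (auto simp: PiE_iff)
  show ?thesis by (rule that[of n]) (rule subsetD[OF X(3) mem])
qed

lemma dense_T_set:
  assumes "0 < \<bar>l\<bar>" "\<bar>l\<bar> < 1"
  shows "D_top closure_of T_set l = carrier D_real"
proof (intro equalityI subsetI)
  fix g assume g: "g \<in> carrier D_real"
  show "g \<in> D_top closure_of T_set l"
    unfolding in_closure_of topspace_D_top
  proof (intro conjI allI impI g)
    fix U assume "g \<in> U \<and> openin D_top U"
    then have "open {x. ser x \<in> U}" "coords g \<in> {x. ser x \<in> U}"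
      using g by (auto simp: openin_D_top ser_coords)
    then obtain n where n: "\<And>x. prescribed n (coords g) x \<in> U"
      unfolding prescribed_def by (rule open_contains_prescribed) auto
    have "\<exists>x. prescribed n (coords g) x \<in> T_set l"
    proof (rule ccontr)
      assume "\<not> ?thesis"
      then have "AE x in unif_seq. False" using AE_prescribed_in_T_set[OF assms, of n "coords g"] by simp
      then show False by simp
    qed
    then obtain x where "prescribed n (coords g) x \<in> T_set l" ..
    then show "\<exists>y. y \<in> T_set l \<and> y \<in> U" using n by blast
  qed
qed (use closure_of_subset_topspace[of D_top "T_set l"] topspace_D_top in blast)

lemma full_measure_T_set:
  assumes "0 < \<bar>l\<bar>" "\<bar>l\<bar> < 1"
  shows "full_measure (T_set l)"
proof -
  have l0: "l \<noteq> 0" using assms(1) by simp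
  note Q = borel_D_proj_T_set[OF l0]
  have "emeasure quot_measure (D_proj ` T_set l) = emeasure unif_seq {x. ser x \<in> T_set l}"
    unfolding quot_measure_def using measurable_pt_unif_seq Q by (simp add: emeasure_distr)
  also have "\<dots> = 1"
  proof -
    have "{x. ser x \<in> T_set l} \<in> sets unif_seq"
      using measurable_sets[OF measurable_pt_unif_seq Q(1)] by (simp add: Q(2))
    moreover have "AE x in unif_seq. x \<in> {x. ser x \<in> T_set l}"
      using AE_prescribed_in_T_set[OF assms, of 0] by simp
    ultimately show ?thesis by (intro unif_seq.emeasure_eq_1_AE)
  qed
  finally show ?thesis
    using borel_T_set[OF l0] right_invariant_T_set[OF l0] by (simp add: full_measure_def D_quot_measure_eq)
qed

theorem theorem6p4p4:
  fixes l :: real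
  assumes "0 < \<bar>l\<bar>" and "\<bar>l\<bar> < 1"
  shows "gdelta_in D_top (T_set l) \<and>
         right_invariant (T_set l) \<and>
         D_top closure_of T_set l = carrier D_real \<and>
         full_measure (T_set l)"
  using assms gdelta_T_set[of l] right_invariant_T_set[of l] dense_T_set[of l] full_measure_T_set[of l]
  by auto

end
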